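(* For every integer $n\ge 1$, the coefficient of $q^{n-1}$ in $\mathsf{Pop}(\mathrm{Weak}(B_n);q)$ equals $3^n-2n-1$. Equivalently, the number of $x\in \mathsf{Pop}_{\mathrm{Weak}(B_n)}(\mathrm{Weak}(B_n))$ with $|\mathscr{U}_{\mathrm{Weak}(B_n)}(x)|=n-1$ is $3^n-2n-1$.
   Context: For a finite lattice $M$ and $x\in M$, $\mathsf{Pop}_M(x)$ is the meet of $x$ together with all elements covered by $x$; $\mathsf{Pop}_M(M)$ is its image; $\mathscr{U}_M(x)$ is the set of elements of $M$ covering $x$; and $\mathsf{Pop}(M;q)=\sum_{b\in\mathsf{Pop}_M(M)} q^{|\mathscr{U}_M(b)|}$. Let $B_n$ be the set of permutations $x=x_1x_2\cdots x_{2n}$ of $\{1,\dots,2n\}$ with $x_i+x_{2n+1-i}=2n+1$ for all $i$. $\mathrm{Weak}(B_n)$ is $B_n$ with the (right) weak order: $x\le y$ iff every pair of values $a<b$ with $b$ appearing before $a$ in $x$ also has $b$ appearing before $a$ in $y$ (this is the weak order of the hyperoctahedral group). In this lattice, $\mathsf{Pop}_{\mathrm{Weak}(B_n)}(x)$ is obtained by reversing each maximal descending run (maximal consecutive decreasing substring) of $x$, and $|\mathscr{U}_{\mathrm{Weak}(B_n)}(x)|=\#\{i\in\{1,\dots,n\}: x_i<x_{i+1}\}$. *)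

theory Defs
  imports
    "HOL-Algebra.Lattice"
    "HOL-Combinatorics.Permutations"
    "HOL-Computational_Algebra.Polynomial"
begin

definition covered_by :: "('a, 'b) gorder_scheme \<Rightarrow> 'a \<Rightarrow> 'a \<Rightarrow> bool" where
  "covered_by M x y \<longleftrightarrow>
     x \<in> carrier M \<and> y \<in> carrier M \<and> x \<sqsubset>\<^bsub>M\<^esub> y \<and>
     \<not> (\<exists>z\<in>carrier M. x \<sqsubset>\<^bsub>M\<^esub> z \<and> z \<sqsubset>\<^bsub>M\<^esub> y)"

definition lower_covers :: "('a, 'b) gorder_scheme \<Rightarrow> 'a \<Rightarrow> 'a set" where
  "lower_covers M x = {y. covered_by M y x}"

definition upper_covers :: "('a, 'b) gorder_scheme \<Rightarrow> 'a \<Rightarrow> 'a set" where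
  "upper_covers M x = {y. covered_by M x y}"

definition Pop :: "('a, 'b) gorder_scheme \<Rightarrow> 'a \<Rightarrow> 'a" where
  "Pop M x = \<Sqinter>\<^bsub>M\<^esub> (insert x (lower_covers M x))"

definition Pop_poly :: "('a, 'b) gorder_scheme \<Rightarrow> int poly" where
  "Pop_poly M = (\<Sum>b \<in> Pop M ` carrier M. monom 1 (card (upper_covers M b)))"

(* The one-line notation of x is x 1, ..., x (2n); as usual for permutes, x is the identity
   outside {1..2n}, so that elements of B n correspond bijectively to such words. *)
definition B :: "nat \<Rightarrow> (nat \<Rightarrow> nat) set" where
  "B n = {x. x permutes {1..2 * n} \<and> (\<forall>i\<in>{1..2 * n}. x i + x (2 * n + 1 - i) = 2 * n + 1)}"

(* Inversions are recorded by values, not by positions: a < b with b appearing before a. *)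
definition inversions :: "nat \<Rightarrow> (nat \<Rightarrow> nat) \<Rightarrow> (nat \<times> nat) set" where
  "inversions n x =
     {(a, b). a < b \<and> (\<exists>i\<in>{1..2 * n}. \<exists>j\<in>{1..2 * n}. i < j \<and> x i = b \<and> x j = a)}"

definition Weak_B :: "nat \<Rightarrow> (nat \<Rightarrow> nat) gorder" where
  "Weak_B n =
     \<lparr> carrier = B n, eq = (=), le = (\<lambda>x y. inversions n x \<subseteq> inversions n y) \<rparr>"

end

theory Submission
  imports Defs "HOL-Library.FuncSet"
begin

text \<open>
  The elements below \<open>x\<close> and all its lower covers are those whose inversions are inversions of
  \<open>x\<close> but not descents of \<open>x\<close>; the greatest of them reverses the descending runs of \<open>x\<close>.
  An element with \<open>n - 1\<close> upper covers has exactly one descent \<open>d\<close> among the positions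
  \<open>1, \<dots>, n\<close>, hence it consists of increasing runs on \<open>1..d\<close>, \<open>d+1..2n-d\<close>, \<open>2n-d+1..2n\<close> and is
  determined by the set \<open>A\<close> of its first \<open>d\<close> values, which contains at most one value of each
  mirror pair \<open>v, 2n+1-v\<close>. There are \<open>3^n\<close> such sets. Position \<open>d\<close> is a descent iff
  \<open>A\<close> is not \<open>{1..d}\<close>. The element is an image of Pop iff reversing its runs creates no new descents,
  which fails exactly when all of \<open>A\<close> lies above its complement, i.e. \<open>A = {2n+1-d..2n}\<close>.
  Excluding the empty set and these two sets for each \<open>d = 1, \<dots>, n\<close> leaves \<open>3^n - 2n - 1\<close>.
\<close>

section \<open>Signed permutations as words\<close>

abbreviation bar :: "nat \<Rightarrow> nat \<Rightarrow> nat" where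
  "bar n v \<equiv> 2 * n + 1 - v"

lemma bar_mem: "v \<in> {1..2 * n} \<Longrightarrow> bar n v \<in> {1..2 * n}"
  by auto

lemma B_permutes: "x \<in> B n \<Longrightarrow> x permutes {1..2 * n}"
  by (simp add: B_def)

lemma B_mem: "x \<in> B n \<Longrightarrow> i \<in> {1..2 * n} \<Longrightarrow> x i \<in> {1..2 * n}"
  by (simp only: B_permutes permutes_in_image)

lemma B_inv_mem: "x \<in> B n \<Longrightarrow> v \<in> {1..2 * n} \<Longrightarrow> inv x v \<in> {1..2 * n}"
  by (simp only: permutes_in_image[OF permutes_inv[OF B_permutes]])

lemma B_inv_apply [simp]: "x \<in> B n \<Longrightarrow> inv x (x i) = i"
  by (rule permutes_inverses(2)[OF B_permutes])

lemma B_apply_inv [simp]: "x \<in> B n \<Longrightarrow> x (inv x i) = i"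
  by (rule permutes_inverses(1)[OF B_permutes])

lemma B_eq_iff: "x \<in> B n \<Longrightarrow> x i = x j \<longleftrightarrow> i = j"
  by (simp add: inj_eq[OF permutes_inj[OF B_permutes]])

lemma B_inv_eq_iff: "x \<in> B n \<Longrightarrow> inv x i = inv x j \<longleftrightarrow> i = j"
  by (simp add: inj_eq[OF permutes_inj[OF permutes_inv[OF B_permutes]]])

lemma B_bar: "x \<in> B n \<Longrightarrow> i \<in> {1..2 * n} \<Longrightarrow> x (bar n i) = bar n (x i)"
proof -
  assume "x \<in> B n" "i \<in> {1..2 * n}"
  then have "x i + x (bar n i) = 2 * n + 1"
    unfolding B_def by blast
  then show "x (bar n i) = bar n (x i)" by linarith
qed

lemma B_inv_bar:
  assumes "x \<in> B n" "v \<in> {1..2 * n}"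
  shows "inv x (bar n v) = bar n (inv x v)"
proof -
  have "x (bar n (inv x v)) = bar n v"
    using B_bar[OF assms(1) B_inv_mem[OF assms]] assms(1) by simp
  then show ?thesis using B_inv_apply[OF assms(1)] by metis
qed

section \<open>Inversion sets and how they determine an element\<close>

lemma inversions_iff:
  assumes "x \<in> B n"
  shows "(a, b) \<in> inversions n x \<longleftrightarrow>
    a < b \<and> a \<in> {1..2 * n} \<and> b \<in> {1..2 * n} \<and> inv x b < inv x a"
proof
  assume "(a, b) \<in> inversions n x"
  then obtain i j where "a < b" "i \<in> {1..2 * n}" "j \<in> {1..2 * n}" "i < j" "b = x i" "a = x j"
    unfolding inversions_def by blast
  then show "a < b \<and> a \<in> {1..2 * n} \<and> b \<in> {1..2 * n} \<and> inv x b < inv x a"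
    using B_mem[OF assms] assms by simp
next
  assume "a < b \<and> a \<in> {1..2 * n} \<and> b \<in> {1..2 * n} \<and> inv x b < inv x a"
  then show "(a, b) \<in> inversions n x"
    unfolding inversions_def using B_inv_mem[OF assms] B_apply_inv[OF assms] by blast
qed

lemma inversions_at:
  assumes "x \<in> B n" "i \<in> {1..2 * n}" "j \<in> {1..2 * n}"
  shows "(x j, x i) \<in> inversions n x \<longleftrightarrow> x j < x i \<and> i < j"
  using assms B_mem[of x n i] B_mem[of x n j] by (simp add: inversions_iff)

text \<open>Mirroring reverses the order of positions and the order of values at once, so inversions
  come in mirror orbits.\<close>

lemma inversions_bar:
  assumes "x \<in> B n" "(a, b) \<in> inversions n x"
  shows "(bar n b, bar n a) \<in> inversions n x"
proof -
  have "a < b" "a \<in> {1..2 * n}" "b \<in> {1..2 * n}" "inv x b < inv x a"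
    using assms by (auto simp: inversions_iff)
  moreover have "inv x a \<in> {1..2 * n}"
    using assms calculation by (intro B_inv_mem) auto
  moreover have "inv x (bar n a) = bar n (inv x a)" "inv x (bar n b) = bar n (inv x b)"
    using B_inv_bar[OF assms(1) calculation(2)] B_inv_bar[OF assms(1) calculation(3)] by auto
  ultimately show ?thesis
    using assms(1) by (simp only: inversions_iff) auto
qed

lemma strict_mono_permutes_id:
  fixes f :: "nat \<Rightarrow> nat"
  assumes f: "f permutes {1..N}" and mono: "\<And>k. k \<in> {1..<N} \<Longrightarrow> f k < f (k + 1)"
  shows "f = id"
proof (rule permutes_natset_ge[OF f], rule ballI)
  fix i assume "i \<in> {1..N}"
  then have "1 \<le> i" "i \<le> N" by auto
  then show "i \<le> f i"
  proof (induction i rule: nat_induct_at_least)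
    case base
    then have "f 1 \<in> {1..N}" using f permutes_in_image[of f "{1..N}" 1] by auto
    then show ?case by simp
  next
    case (Suc i)
    then show ?case using mono[of i] by simp
  qed
qed

text \<open>The map \<open>inv y \<circ> x\<close> permutes the positions and increases at every
  step, which leaves only the identity.\<close>

lemma B_eqI_adjacent:
  assumes "x \<in> B n" "y \<in> B n"
    and "\<And>k. k \<in> {1..<2 * n} \<Longrightarrow> inv y (x k) < inv y (x (k + 1))"
  shows "y = x"
proof -
  have "inv y \<circ> x = id"
    using assms B_permutes permutes_compose permutes_inv
    by (intro strict_mono_permutes_id[of _ "2 * n"]) (auto intro!: permutes_compose permutes_inv)
  then show ?thesis
    by (metis B_apply_inv assms(2) comp_apply ext id_apply)
qed

text \<open>For adjacent entries of x the common inversion set dictates that y lists them in the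
  same order as x does. This is the antisymmetry of the weak order.\<close>

lemma inversions_inject:
  assumes x: "x \<in> B n" and y: "y \<in> B n" and eq: "inversions n x = inversions n y"
  shows "x = y"
proof (rule sym, rule B_eqI_adjacent[OF x y])
  fix k assume k: "k \<in> {1..<2 * n}"
  then have mem: "x k \<in> {1..2 * n}" "x (k + 1) \<in> {1..2 * n}"
    using B_mem[OF x, of k] B_mem[OF x, of "k + 1"] by auto
  have ne: "x k \<noteq> x (k + 1)" "inv y (x k) \<noteq> inv y (x (k + 1))"
    using x y by (auto simp: B_eq_iff B_inv_eq_iff)
  show "inv y (x k) < inv y (x (k + 1))"
  proof (cases "x k < x (k + 1)")
    case True
    then have "(x k, x (k + 1)) \<notin> inversions n x" using x k inversions_iff by auto
    then show ?thesis using eq mem y ne True by (auto simp: inversions_iff)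
  next
    case False
    then have "(x (k + 1), x k) \<in> inversions n x" using x k ne mem inversions_iff by auto
    then show ?thesis using eq y by (auto simp: inversions_iff)
  qed
qed

text \<open>The source of new elements of \<open>B n\<close>: list the values by increasing key. The
  rank of the keys is the inverse of that word. The constant sum of mirror keys makes
  \<open>bar n\<close> reverse the key order, which yields the symmetry demanded by
  \<open>B n\<close>.\<close>

lemma B_sorted_by_key_exists:
  fixes key :: "nat \<Rightarrow> nat"
  assumes inj: "inj_on key {1..2 * n}"
    and sym: "\<And>v. v \<in> {1..2 * n} \<Longrightarrow> key v + key (bar n v) = C"
  shows "\<exists>w\<in>B n. \<forall>u\<in>{1..2 * n}. \<forall>v\<in>{1..2 * n}. inv w u < inv w v \<longleftrightarrow> key u < key v"
proof -
  let ?I = "{1..2 * n}"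
  define r where "r v = (if v \<in> ?I then card {u \<in> ?I. key u \<le> key v} else v)" for v
  have r_mono: "r u < r v" if "u \<in> ?I" "v \<in> ?I" "key u < key v" for u v
  proof -
    have "{t \<in> ?I. key t \<le> key u} \<subseteq> {t \<in> ?I. key t \<le> key v}"
      "v \<in> {t \<in> ?I. key t \<le> key v} - {t \<in> ?I. key t \<le> key u}"
      using that by auto
    then have "{t \<in> ?I. key t \<le> key u} \<subset> {t \<in> ?I. key t \<le> key v}" by blast
    then show ?thesis using that by (simp add: r_def psubset_card_mono del: atLeastAtMost_iff)
  qed
  have r_less_iff: "r u < r v \<longleftrightarrow> key u < key v" if "u \<in> ?I" "v \<in> ?I" for u v
    using r_mono[of u v] r_mono[of v u] inj_onD[OF inj _ that] that
    by (metis less_asym less_irrefl linorder_neqE_nat)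
  have r_mem: "r v \<in> ?I" if "v \<in> ?I" for v
  proof -
    have "{u \<in> ?I. key u \<le> key v} \<noteq> {}" using that by auto
    then have "0 < card {u \<in> ?I. key u \<le> key v}" by (simp add: card_gt_0_iff)
    moreover have "card {u \<in> ?I. key u \<le> key v} \<le> card ?I" by (rule card_mono) auto
    ultimately show ?thesis using that by (simp add: r_def)
  qed
  have "inj_on r ?I"
    by (rule inj_onI) (metis r_less_iff inj inj_onD less_irrefl linorder_neqE_nat)
  moreover have "r ` ?I \<subseteq> ?I" using r_mem by blast
  ultimately have "bij_betw r ?I ?I"
    by (simp add: bij_betw_def endo_inj_surj)
  then have r: "r permutes ?I"
    by (rule bij_imp_permutes) (unfold r_def, rule if_not_P)
  have r_bar: "r v + r (bar n v) = 2 * n + 1" if v: "v \<in> ?I" for v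
  proof -
    \<comment> \<open>The rank of \<open>bar n v\<close> is the rank of v counted from the top. The
      counts from below and from above overlap only in v itself, hence the sum
      \<open>2 * n + 1\<close>.\<close>
    have "bij_betw (bar n) {u \<in> ?I. key v \<le> key u} {u \<in> ?I. key u \<le> key (bar n v)}"
    proof (rule bij_betwI[where g = "bar n"])
      have "key (bar n u) \<le> key (bar n v) \<longleftrightarrow> key v \<le> key u" if "u \<in> ?I" for u
        using sym[OF v] sym[OF that] by linarith
      then show "bar n \<in> {u \<in> ?I. key v \<le> key u} \<rightarrow> {u \<in> ?I. key u \<le> key (bar n v)}"
        using bar_mem by auto
      have "key v \<le> key (bar n u) \<longleftrightarrow> key u \<le> key (bar n v)" if "u \<in> ?I" for u
        using sym[OF v] sym[OF that] by linarith
      then show "bar n \<in> {u \<in> ?I. key u \<le> key (bar n v)} \<rightarrow> {u \<in> ?I. key v \<le> key u}"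
        using bar_mem by auto
    qed auto
    then have "r (bar n v) = card {u \<in> ?I. key v \<le> key u}"
      using bar_mem[OF v] by (simp add: r_def bij_betw_same_card)
    moreover have "card {u \<in> ?I. key u \<le> key v} + card {u \<in> ?I. key v \<le> key u} = 2 * n + 1"
    proof -
      have "{u \<in> ?I. key u \<le> key v} \<union> {u \<in> ?I. key v \<le> key u} = ?I"
        by auto
      moreover have "{u \<in> ?I. key u \<le> key v} \<inter> {u \<in> ?I. key v \<le> key u} = {v}"
        using v inj_onD[OF inj _ _ v] by (blast intro: order_antisym)
      ultimately show ?thesis
        using card_Un_Int[of "{u \<in> ?I. key u \<le> key v}" "{u \<in> ?I. key v \<le> key u}"] by simp
    qed
    ultimately show ?thesis using v by (simp add: r_def)
  qed
  have "inv r \<in> B n"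
    unfolding B_def
  proof (intro CollectI conjI ballI)
    show inv_r: "inv r permutes ?I" by (rule permutes_inv[OF r])
    fix i assume "i \<in> ?I"
    then have v: "inv r i \<in> ?I" using permutes_in_image[OF inv_r] by simp
    have "r (bar n (inv r i)) = bar n i"
      using r_bar[OF v] permutes_inverses(1)[OF r, of i] by simp
    then have "inv r (bar n i) = bar n (inv r i)"
      by (metis permutes_inverses(2)[OF r])
    then show "inv r i + inv r (2 * n + 1 - i) = 2 * n + 1" using v by simp
  qed
  then show ?thesis
    using r_less_iff permutes_inv_inv[OF r] by metis
qed

section \<open>Reversing runs\<close>

lemma bar_step:
  assumes "x \<in> B n" "k \<in> {1..<2 * n}"
  shows "x (2 * n - k) = bar n (x (k + 1))" "x (2 * n - k + 1) = bar n (x k)"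
proof -
  have "k + 1 \<in> {1..2 * n}" "k \<in> {1..2 * n}" using assms(2) by auto
  moreover have "2 * n - k = bar n (k + 1)" "2 * n - k + 1 = bar n k" using assms(2) by auto
  ultimately show "x (2 * n - k) = bar n (x (k + 1))" "x (2 * n - k + 1) = bar n (x k)"
    using B_bar[OF assms(1)] by metis+
qed

lemma descent_mirror:
  assumes "x \<in> B n" "k \<in> {1..<2 * n}"
  shows "x (2 * n - k + 1) < x (2 * n - k) \<longleftrightarrow> x (k + 1) < x k"
proof -
  have "x k \<in> {1..2 * n}" "x (k + 1) \<in> {1..2 * n}"
    using assms(2) B_mem[OF assms(1), of k] B_mem[OF assms(1), of "k + 1"] by auto
  then show ?thesis unfolding bar_step[OF assms] by auto
qed

text \<open>The mirror of the adjacent positions k and \<open>k + 1\<close> starts at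
  \<open>2 * n - k\<close>. A set of gluing positions must respect this for block reversal to stay
  inside \<open>B n\<close>.\<close>

definition mirror_symmetric :: "nat \<Rightarrow> nat set \<Rightarrow> bool" where
  "mirror_symmetric n D \<longleftrightarrow> (\<forall>k\<in>{1..<2 * n}. 2 * n - k \<in> D \<longleftrightarrow> k \<in> D)"

text \<open>\<open>D\<close> is the set of positions \<open>k\<close> glued to \<open>k + 1\<close>; each maximal glued block of \<open>x\<close> is
  reversed.\<close>

definition flip :: "nat \<Rightarrow> nat set \<Rightarrow> (nat \<Rightarrow> nat) \<Rightarrow> nat \<Rightarrow> nat" where
  "flip n D x = (SOME w. w \<in> B n \<and> (\<forall>i\<in>{1..2 * n}. \<forall>j\<in>{1..2 * n}. i < j \<longrightarrow>
     (inv w (x i) < inv w (x j) \<longleftrightarrow> \<not> {i..<j} \<subseteq> D)))"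

lemma flip_exists:
  assumes x: "x \<in> B n" and D: "mirror_symmetric n D"
  shows "\<exists>w. w \<in> B n \<and> (\<forall>i\<in>{1..2 * n}. \<forall>j\<in>{1..2 * n}. i < j \<longrightarrow>
     (inv w (x i) < inv w (x j) \<longleftrightarrow> \<not> {i..<j} \<subseteq> D))"
proof -
  let ?I = "{1..2 * n}" and ?K = "2 * n + 1"
  \<comment> \<open>\<open>c i\<close> counts the cuts before position i and so numbers the glued
    blocks. The key sorts by block first and by decreasing position second; for values in range the
    second summand stays below \<open>?K\<close>, so it cannot disturb the first.\<close>
  define c where "c i = card ({1..<i} - D)" for i
  define key where "key v = c (inv x v) * ?K + (?K - inv x v)" for v
  have c_split: "c j = c i + card ({i..<j} - D)" if "i \<in> ?I" "i \<le> j" for i j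
  proof -
    have "{1..<j} - D = ({1..<i} - D) \<union> ({i..<j} - D)" using that by auto
    then show ?thesis unfolding c_def by (simp only:) (rule card_Un_disjoint, auto)
  qed
  have c_bar: "c i + c (bar n i) = c (2 * n)" if i: "i \<in> ?I" for i
  proof -
    \<comment> \<open>Mirroring turns the cuts before \<open>bar n i\<close> into the cuts from i
      on, so the block numbers of mirror positions have a constant sum.\<close>
    have "bij_betw (\<lambda>k. 2 * n - k) ({1..<bar n i} - D) ({i..<2 * n} - D)"
      using D i unfolding mirror_symmetric_def
      by (intro bij_betwI[where g = "\<lambda>k. 2 * n - k"]) auto
    then have "c (bar n i) = card ({i..<2 * n} - D)"
      unfolding c_def by (rule bij_betw_same_card)
    then show ?thesis using c_split[of i "2 * n"] i by simp
  qed
  have "inj_on key ?I"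
  proof (rule inj_onI)
    fix u v assume uv: "u \<in> ?I" "v \<in> ?I" and eq: "key u = key v"
    have mem: "inv x u \<in> ?I" "inv x v \<in> ?I" using uv B_inv_mem[OF x] by auto
    \<comment> \<open>Reduction modulo \<open>?K\<close> isolates the second summand, which
      determines the position.\<close>
    have "key u mod ?K = key v mod ?K" by (simp only: eq)
    moreover have "key u mod ?K = ?K - inv x u" "key v mod ?K = ?K - inv x v"
      unfolding key_def using mem by (simp_all only: mod_mult_self3) (auto intro!: mod_less)
    ultimately have "inv x u = inv x v" using mem by auto
    then show "u = v" using x by (simp add: B_inv_eq_iff)
  qed
  moreover have "key v + key (bar n v) = (c (2 * n) + 1) * ?K" if v: "v \<in> ?I" for v
  proof -
    have mem: "inv x v \<in> ?I" using v by (rule B_inv_mem[OF x])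
    have "key v + key (bar n v) = (c (inv x v) + c (bar n (inv x v))) * ?K +
        ((?K - inv x v) + (?K - bar n (inv x v)))"
      unfolding key_def B_inv_bar[OF x v] by (simp only: add_mult_distrib)
    also have "(?K - inv x v) + (?K - bar n (inv x v)) = ?K" using mem by auto
    finally show ?thesis using c_bar[OF mem] by simp
  qed
  ultimately obtain w where w: "w \<in> B n"
    and less: "\<And>u v. u \<in> ?I \<Longrightarrow> v \<in> ?I \<Longrightarrow> inv w u < inv w v \<longleftrightarrow> key u < key v"
    using B_sorted_by_key_exists[of key n] by blast
  have "inv w (x i) < inv w (x j) \<longleftrightarrow> \<not> {i..<j} \<subseteq> D" if ij: "i \<in> ?I" "j \<in> ?I" "i < j" for i j
  proof -
    have key_x: "key (x i) = c i * ?K + (?K - i)" "key (x j) = c j * ?K + (?K - j)"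
      using x by (simp_all add: key_def)
    have c_j: "c j = c i + card ({i..<j} - D)" using c_split[of i j] ij by simp
    have "key (x i) < key (x j) \<longleftrightarrow> \<not> {i..<j} \<subseteq> D"
    proof (cases "{i..<j} \<subseteq> D")
      case True
      then have "c j = c i" using c_j by (simp add: Diff_eq_empty_iff[THEN iffD2])
      then show ?thesis using True ij unfolding key_x by auto
    next
      case False
      then have "{i..<j} - D \<noteq> {}" by blast
      then have "c i + 1 \<le> c j" using c_j by (simp add: Suc_leI card_gt_0_iff)
      then have "(c i + 1) * ?K \<le> c j * ?K" by (rule mult_le_mono1)
      then have "c i * ?K + ?K \<le> c j * ?K" by (simp only: add_mult_distrib mult_1)
      then have "key (x i) < key (x j)" unfolding key_x using ij by simp
      then show ?thesis using False by simp
    qed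
    then show ?thesis using less[OF B_mem[OF x ij(1)] B_mem[OF x ij(2)]] by simp
  qed
  then show ?thesis using w by blast
qed

lemma flip_mem: "x \<in> B n \<Longrightarrow> mirror_symmetric n D \<Longrightarrow> flip n D x \<in> B n"
  unfolding flip_def by (rule someI2_ex[OF flip_exists]) auto

lemma inv_flip_less_iff:
  assumes "x \<in> B n" "mirror_symmetric n D" "i \<in> {1..2 * n}" "j \<in> {1..2 * n}" "i < j"
  shows "inv (flip n D x) (x i) < inv (flip n D x) (x j) \<longleftrightarrow> \<not> {i..<j} \<subseteq> D"
  unfolding flip_def by (rule someI2_ex[OF flip_exists[OF assms(1,2)]]) (use assms in blast)

lemma inv_flip_greater_iff:
  assumes "x \<in> B n" "mirror_symmetric n D" "i \<in> {1..2 * n}" "j \<in> {1..2 * n}" "i < j"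
  shows "inv (flip n D x) (x j) < inv (flip n D x) (x i) \<longleftrightarrow> {i..<j} \<subseteq> D"
proof -
  have "inv (flip n D x) (x i) \<noteq> inv (flip n D x) (x j)"
    using assms flip_mem[OF assms(1,2)] by (simp add: B_inv_eq_iff B_eq_iff)
  then show ?thesis using inv_flip_less_iff[OF assms] by linarith
qed

section \<open>The effect of flips on inversion sets\<close>

lemma less_of_step_less:
  fixes f :: "nat \<Rightarrow> 'a::order"
  assumes "i < j" "\<And>k. k \<in> {i..<j} \<Longrightarrow> f k < f (k + 1)"
  shows "f i < f j"
  using assms
proof (induction j)
  case (Suc j)
  then show ?case
    by (cases "i = j") (auto intro: less_trans[of "f i" "f j"])
qed simp

lemma greater_of_step_greater:
  fixes f :: "nat \<Rightarrow> 'a::order"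
  assumes "i < j" "\<And>k. k \<in> {i..<j} \<Longrightarrow> f (k + 1) < f k"
  shows "f j < f i"
  using assms
proof (induction j)
  case (Suc j)
  then show ?case
    by (cases "i = j") (auto intro: less_trans[of _ "f j"])
qed simp

text \<open>Pairs in different blocks keep their order. Within a block of descents every pair is
  inverted in x, and the reversal undoes exactly these inversions.\<close>

lemma flip_descending:
  assumes x: "x \<in> B n" and D: "mirror_symmetric n D"
    and desc: "\<And>k. k \<in> D \<Longrightarrow> x (k + 1) < x k"
  shows "(a, b) \<in> inversions n (flip n D x) \<longleftrightarrow>
    (a, b) \<in> inversions n x \<and> \<not> {inv x b..<inv x a} \<subseteq> D"
proof (cases "a < b \<and> a \<in> {1..2 * n} \<and> b \<in> {1..2 * n}")
  case True
  define i j where "i = inv x b" and "j = inv x a"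
  have ij: "i \<in> {1..2 * n}" "j \<in> {1..2 * n}" "x i = b" "x j = a"
    using True x B_inv_mem[OF x] by (auto simp: i_def j_def)
  then have "i \<noteq> j" using True by auto
  then consider "i < j" | "j < i" by linarith
  then show ?thesis
  proof cases
    case 1
    then show ?thesis
      using inv_flip_less_iff[OF x D ij(1,2)] ij(3,4) True
      by (auto simp: inversions_iff[OF x] inversions_iff[OF flip_mem[OF x D]] i_def j_def)
  next
    case 2
    have "\<not> {j..<i} \<subseteq> D"
    proof
      assume "{j..<i} \<subseteq> D"
      then have "x i < x j" using 2 desc greater_of_step_greater[of j i x] by blast
      then show False using ij(3,4) True by simp
    qed
    then have "\<not> inv (flip n D x) b < inv (flip n D x) a"
      using inv_flip_greater_iff[OF x D ij(2,1) 2] ij(3,4) by simp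
    then show ?thesis
      using 2 by (auto simp: inversions_iff[OF x] inversions_iff[OF flip_mem[OF x D]] i_def j_def)
  qed
qed (auto simp: inversions_iff[OF x] inversions_iff[OF flip_mem[OF x D]])

text \<open>The dual case: within a block of ascents no pair is inverted, and the reversal inverts
  all of them.\<close>

lemma flip_ascending:
  assumes x: "x \<in> B n" and D: "mirror_symmetric n D"
    and asc: "\<And>k. k \<in> D \<Longrightarrow> x k < x (k + 1)"
  shows "(a, b) \<in> inversions n (flip n D x) \<longleftrightarrow> (a, b) \<in> inversions n x \<or>
    a \<in> {1..2 * n} \<and> b \<in> {1..2 * n} \<and> inv x a < inv x b \<and> {inv x a..<inv x b} \<subseteq> D"
proof (cases "a < b \<and> a \<in> {1..2 * n} \<and> b \<in> {1..2 * n}")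
  case True
  define i j where "i = inv x b" and "j = inv x a"
  have ij: "i \<in> {1..2 * n}" "j \<in> {1..2 * n}" "x i = b" "x j = a"
    using True x B_inv_mem[OF x] by (auto simp: i_def j_def)
  then have "i \<noteq> j" using True by auto
  then consider "i < j" | "j < i" by linarith
  then show ?thesis
  proof cases
    case 1
    have "\<not> {i..<j} \<subseteq> D"
    proof
      assume "{i..<j} \<subseteq> D"
      then have "x i < x j" using 1 asc less_of_step_less[of i j x] by blast
      then show False using ij(3,4) True by simp
    qed
    then have "inv (flip n D x) b < inv (flip n D x) a"
      using inv_flip_less_iff[OF x D ij(1,2) 1] ij(3,4) by simp
    then show ?thesis
      using 1 True by (auto simp: inversions_iff[OF x] inversions_iff[OF flip_mem[OF x D]] i_def j_def)
  next
    case 2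
    then show ?thesis
      using inv_flip_greater_iff[OF x D ij(2,1) 2] ij(3,4) True
      by (auto simp: inversions_iff[OF x] inversions_iff[OF flip_mem[OF x D]] i_def j_def)
  qed
next
  case False
  \<comment> \<open>The new inversions are described by positions alone; that the values are ordered
    as well follows because x increases along a glued block.\<close>
  have "a < b" if "a \<in> {1..2 * n}" "b \<in> {1..2 * n}" "inv x a < inv x b" "{inv x a..<inv x b} \<subseteq> D"
  proof -
    have "x (inv x a) < x (inv x b)"
      using less_of_step_less[of "inv x a" "inv x b" x] that(3,4) asc by blast
    then show ?thesis using x by simp
  qed
  then show ?thesis
    using False by (auto simp: inversions_iff[OF x] inversions_iff[OF flip_mem[OF x D]])
qed

section \<open>Covers and the operator Pop\<close>

text \<open>Positions range over the whole word and not only over its first half, so that the set is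
  mirror symmetric and can serve as a gluing set for \<open>flip\<close>.\<close>

definition descents :: "nat \<Rightarrow> (nat \<Rightarrow> nat) \<Rightarrow> nat set" where
  "descents n x = {k \<in> {1..<2 * n}. x (k + 1) < x k}"

definition ascents :: "nat \<Rightarrow> (nat \<Rightarrow> nat) \<Rightarrow> nat set" where
  "ascents n x = {k \<in> {1..<2 * n}. x k < x (k + 1)}"

lemma ascents_conv_descents:
  assumes "x \<in> B n"
  shows "ascents n x = {1..<2 * n} - descents n x"
proof -
  have "x k \<noteq> x (k + 1)" for k using assms by (simp add: B_eq_iff)
  then show ?thesis unfolding ascents_def descents_def by (auto simp: not_less order_less_le)
qed

lemma mirror_symmetric_descents: "x \<in> B n \<Longrightarrow> mirror_symmetric n (descents n x)"
  unfolding mirror_symmetric_def descents_def using descent_mirror by auto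

section \<open>Exchanging two adjacent entries together with their mirror images\<close>

lemma mirror_symmetric_pair: "mirror_symmetric n {k, 2 * n - k}" if "k \<in> {1..<2 * n}"
  using that unfolding mirror_symmetric_def by auto

text \<open>Right multiplication by a simple reflection of the hyperoctahedral group. For
  \<open>k = n\<close> the gluing set is a singleton and only the two middle entries are
  exchanged.\<close>

abbreviation swap :: "nat \<Rightarrow> nat \<Rightarrow> (nat \<Rightarrow> nat) \<Rightarrow> nat \<Rightarrow> nat" where
  "swap n k \<equiv> flip n {k, 2 * n - k}"

lemma swap_mem: "x \<in> B n \<Longrightarrow> k \<in> {1..<2 * n} \<Longrightarrow> swap n k x \<in> B n"
  by (intro flip_mem mirror_symmetric_pair)

text \<open>The numbers k and \<open>2 * n - k\<close> have the same parity, so they are never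
  consecutive and no glued block has more than two positions.\<close>

lemma run_subset_pair:
  fixes i j k n :: nat
  assumes k: "k \<in> {1..<2 * n}"
  shows "i < j \<and> {i..<j} \<subseteq> {k, 2 * n - k} \<longleftrightarrow>
    (i = k \<and> j = k + 1) \<or> (i = 2 * n - k \<and> j = 2 * n - k + 1)"
proof
  assume sub: "i < j \<and> {i..<j} \<subseteq> {k, 2 * n - k}"
  then have "i \<in> {i..<j}" by simp
  then have i: "i = k \<or> i = 2 * n - k" using sub by blast
  have "j = i + 1"
  proof (rule ccontr)
    assume "j \<noteq> i + 1"
    then have "i + 1 \<in> {i..<j}" using sub by simp
    then have "i + 1 = k \<or> i + 1 = 2 * n - k" using sub by blast
    then show False using i k unfolding atLeastLessThan_iff by presburger
  qed
  then show "(i = k \<and> j = k + 1) \<or> (i = 2 * n - k \<and> j = 2 * n - k + 1)" using i by blast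
qed auto

lemma B_inv_eq_conv: "x \<in> B n \<Longrightarrow> inv x v = i \<longleftrightarrow> v = x i"
  using B_apply_inv[of x n v] by auto

text \<open>By \<open>run_subset_pair\<close> only the adjacent pair and its mirror image lie inside
  a reversed block, so exactly one mirror orbit of inversions is lost.\<close>

lemma inversions_swap_descent:
  assumes x: "x \<in> B n" and k: "k \<in> {1..<2 * n}" and desc: "x (k + 1) < x k"
  shows "inversions n x = inversions n (swap n k x) \<union>
      {(x (k + 1), x k), (bar n (x k), bar n (x (k + 1)))}"
    and "(x (k + 1), x k) \<notin> inversions n (swap n k x)"
proof -
  have mirror: "x (2 * n - k + 1) < x (2 * n - k)"
    using descent_mirror[OF x k] desc by simp
  have iff: "(a, b) \<in> inversions n (swap n k x) \<longleftrightarrow>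
      (a, b) \<in> inversions n x \<and> \<not> {inv x b..<inv x a} \<subseteq> {k, 2 * n - k}" for a b
    by (rule flip_descending[OF x mirror_symmetric_pair[OF k]]) (use desc mirror in blast)
  have iff': "(a, b) \<in> inversions n (swap n k x) \<longleftrightarrow> (a, b) \<in> inversions n x \<and>
      (a, b) \<notin> {(x (k + 1), x k), (bar n (x k), bar n (x (k + 1)))}" for a b
  proof (cases "(a, b) \<in> inversions n x")
    case True
    then have "inv x b < inv x a" using inversions_iff[OF x] by blast
    then have "{inv x b..<inv x a} \<subseteq> {k, 2 * n - k} \<longleftrightarrow>
        (inv x b = k \<and> inv x a = k + 1) \<or> (inv x b = 2 * n - k \<and> inv x a = 2 * n - k + 1)"
      using run_subset_pair[OF k, of "inv x b" "inv x a"] by blast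
    then show ?thesis
      using True iff unfolding B_inv_eq_conv[OF x] bar_step[OF x k] by blast
  qed (use iff in blast)
  have k': "k \<in> {1..2 * n}" "k + 1 \<in> {1..2 * n}" using k by auto
  then have mem: "(x (k + 1), x k) \<in> inversions n x"
    using inversions_at[OF x k'] desc by simp
  then show "inversions n x = inversions n (swap n k x) \<union>
      {(x (k + 1), x k), (bar n (x k), bar n (x (k + 1)))}"
    using inversions_bar[OF x mem] iff' by auto
  show "(x (k + 1), x k) \<notin> inversions n (swap n k x)" using iff' by blast
qed

text \<open>Dually, exchanging at an ascent gains exactly one mirror orbit of inversions.\<close>

lemma inversions_swap_ascent:
  assumes x: "x \<in> B n" and k: "k \<in> {1..<2 * n}" and asc: "x k < x (k + 1)"
  shows "inversions n (swap n k x) = inversions n x \<union>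
      {(x k, x (k + 1)), (bar n (x (k + 1)), bar n (x k))}"
    and "(x k, x (k + 1)) \<notin> inversions n x"
proof -
  have k': "k \<in> {1..2 * n}" "k + 1 \<in> {1..2 * n}" "2 * n - k \<in> {1..2 * n}" "2 * n - k + 1 \<in> {1..2 * n}"
    using k by auto
  have "\<not> x (2 * n - k + 1) < x (2 * n - k)" "x (2 * n - k + 1) \<noteq> x (2 * n - k)"
    using descent_mirror[OF x k] asc x by (auto simp: B_eq_iff)
  then have mirror: "x (2 * n - k) < x (2 * n - k + 1)" by linarith
  have iff: "(a, b) \<in> inversions n (swap n k x) \<longleftrightarrow> (a, b) \<in> inversions n x \<or>
      a \<in> {1..2 * n} \<and> b \<in> {1..2 * n} \<and> inv x a < inv x b \<and>
      {inv x a..<inv x b} \<subseteq> {k, 2 * n - k}" for a b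
    by (rule flip_ascending[OF x mirror_symmetric_pair[OF k]]) (use asc mirror in blast)
  have pair: "inv x a < inv x b \<and> {inv x a..<inv x b} \<subseteq> {k, 2 * n - k} \<longleftrightarrow>
      (a, b) \<in> {(x k, x (k + 1)), (x (2 * n - k), x (2 * n - k + 1))}" for a b
  proof -
    show ?thesis
      unfolding run_subset_pair[OF k] B_inv_eq_conv[OF x] by blast
  qed
  have "a \<in> {1..2 * n} \<and> b \<in> {1..2 * n}"
    if "(a, b) \<in> {(x k, x (k + 1)), (x (2 * n - k), x (2 * n - k + 1))}" for a b
    using that B_mem[OF x k'(1)] B_mem[OF x k'(2)] B_mem[OF x k'(3)] B_mem[OF x k'(4)] by blast
  then have "(a, b) \<in> inversions n (swap n k x) \<longleftrightarrow> (a, b) \<in> inversions n x \<or>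
      (a, b) \<in> {(x k, x (k + 1)), (x (2 * n - k), x (2 * n - k + 1))}" for a b
    using iff[of a b] pair[of a b] by blast
  then show "inversions n (swap n k x) = inversions n x \<union>
      {(x k, x (k + 1)), (bar n (x (k + 1)), bar n (x k))}"
    unfolding bar_step[OF x k] by auto
  show "(x k, x (k + 1)) \<notin> inversions n x"
    using inversions_at[OF x k'(2,1)] by simp
qed

section \<open>The covering relation of the weak order\<close>

lemma carrier_Weak_B [simp]: "carrier (Weak_B n) = B n"
  by (simp add: Weak_B_def)

lemma le_Weak_B [simp]: "le (Weak_B n) x y \<longleftrightarrow> inversions n x \<subseteq> inversions n y"
  by (simp add: Weak_B_def)

lemma lless_Weak_B:
  "x \<in> B n \<Longrightarrow> y \<in> B n \<Longrightarrow> lless (Weak_B n) x y \<longleftrightarrow> inversions n x \<subset> inversions n y"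
  using inversions_inject by (auto simp: Weak_B_def lless_def)

lemma covered_by_Weak_B:
  "covered_by (Weak_B n) x y \<longleftrightarrow> x \<in> B n \<and> y \<in> B n \<and> inversions n x \<subset> inversions n y \<and>
    \<not> (\<exists>z\<in>B n. inversions n x \<subset> inversions n z \<and> inversions n z \<subset> inversions n y)"
  by (simp add: covered_by_def lless_Weak_B cong: conj_cong bex_cong)

text \<open>Inversion sets are closed under mirroring, so a set strictly in between would have to
  contain one member of the added orbit and then the other.\<close>

lemma covered_by_of_mirror_pair:
  assumes x: "x \<in> B n" and y: "y \<in> B n" and nin: "(a, b) \<notin> inversions n x"
    and eq: "inversions n y = inversions n x \<union> {(a, b), (bar n b, bar n a)}"
  shows "covered_by (Weak_B n) x y"
proof -
  have "(a, b) \<in> inversions n y" using eq by blast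
  then have ab: "bar n (bar n a) = a" "bar n (bar n b) = b" using inversions_iff[OF y] by auto
  have False if z: "z \<in> B n" and less: "inversions n x \<subset> inversions n z" "inversions n z \<subset> inversions n y" for z
  proof -
    have "(a, b) \<in> inversions n z \<or> (bar n b, bar n a) \<in> inversions n z"
      using less eq by blast
    then have "(a, b) \<in> inversions n z \<and> (bar n b, bar n a) \<in> inversions n z"
      using inversions_bar[OF z, of a b] inversions_bar[OF z, of "bar n b" "bar n a"] unfolding ab by blast
    then show False using less eq by blast
  qed
  moreover have "inversions n x \<subset> inversions n y" using eq nin by blast
  ultimately show ?thesis unfolding covered_by_Weak_B using x y by blast
qed

text \<open>Supplies the position at which exchanging entries of x moves x towards y.\<close>

lemma adjacent_disagreement:
  assumes "x \<in> B n" "y \<in> B n" "x \<noteq> y"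
  obtains k where "k \<in> {1..<2 * n}" "inv y (x (k + 1)) < inv y (x k)"
proof -
  obtain k where k: "k \<in> {1..<2 * n}" "\<not> inv y (x k) < inv y (x (k + 1))"
    using B_eqI_adjacent[OF assms(1,2)] assms(3) by blast
  moreover have "inv y (x k) \<noteq> inv y (x (k + 1))" using assms(1,2) by (simp add: B_inv_eq_iff B_eq_iff)
  ultimately show ?thesis using that by force
qed

text \<open>If y lies below x, a position where y disagrees with x must be a descent of x. The
  exchange there gives an element above y and strictly below x, which equals y when y is a lower
  cover.\<close>

lemma lower_covers_Weak_B:
  assumes x: "x \<in> B n"
  shows "lower_covers (Weak_B n) x = (\<lambda>k. swap n k x) ` descents n x"
proof (intro equalityI subsetI)
  fix y assume "y \<in> (\<lambda>k. swap n k x) ` descents n x"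
  then obtain k where k: "k \<in> {1..<2 * n}" "x (k + 1) < x k" "y = swap n k x"
    by (auto simp: descents_def)
  then show "y \<in> lower_covers (Weak_B n) x"
    unfolding lower_covers_def mem_Collect_eq
    using covered_by_of_mirror_pair[OF swap_mem[OF x k(1)] x] inversions_swap_descent[OF x k(1,2)] by metis
next
  fix y assume "y \<in> lower_covers (Weak_B n) x"
  then have y: "y \<in> B n" "inversions n y \<subset> inversions n x"
    "\<And>z. z \<in> B n \<Longrightarrow> inversions n y \<subset> inversions n z \<Longrightarrow> \<not> inversions n z \<subset> inversions n x"
    unfolding lower_covers_def covered_by_Weak_B by auto
  then obtain k where k: "k \<in> {1..<2 * n}" "inv y (x (k + 1)) < inv y (x k)"
    using adjacent_disagreement[OF x, of y] by blast
  have mem: "x k \<in> {1..2 * n}" "x (k + 1) \<in> {1..2 * n}"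
    using k(1) B_mem[OF x, of k] B_mem[OF x, of "k + 1"] by auto
  have "\<not> x k < x (k + 1)"
  proof
    assume "x k < x (k + 1)"
    then have "(x k, x (k + 1)) \<in> inversions n x" using k mem y(1,2) inversions_iff[OF y(1)] by blast
    then show False using x by (simp add: inversions_iff)
  qed
  moreover have "x k \<noteq> x (k + 1)" using x by (simp add: B_eq_iff)
  ultimately have desc: "x (k + 1) < x k" by linarith
  note swap = inversions_swap_descent[OF x k(1) desc] swap_mem[OF x k(1)]
  have nin: "(x (k + 1), x k) \<notin> inversions n y" using k(2) inversions_iff[OF y(1)] by auto
  moreover have "(bar n (x k), bar n (x (k + 1))) \<notin> inversions n y"
  proof
    assume "(bar n (x k), bar n (x (k + 1))) \<in> inversions n y"
    from inversions_bar[OF y(1) this] show False using nin mem by simp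
  qed
  ultimately have "inversions n y \<subseteq> inversions n (swap n k x)" using swap(1) y(2) by blast
  moreover have "inversions n (swap n k x) \<subset> inversions n x" using swap(1,2) by blast
  ultimately have "inversions n y = inversions n (swap n k x)" using y(3)[OF swap(3)] by blast
  then have "y = swap n k x" by (rule inversions_inject[OF y(1) swap(3)])
  then show "y \<in> (\<lambda>k. swap n k x) ` descents n x" using k(1) desc by (auto simp: descents_def)
qed

text \<open>Dual to \<open>lower_covers_Weak_B\<close>: a disagreement with an element above x
  occurs at an ascent of x, and the exchange there stays below that element.\<close>

lemma upper_covers_Weak_B:
  assumes x: "x \<in> B n"
  shows "upper_covers (Weak_B n) x = (\<lambda>k. swap n k x) ` ascents n x"
proof (intro equalityI subsetI)
  fix y assume "y \<in> (\<lambda>k. swap n k x) ` ascents n x"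
  then obtain k where k: "k \<in> {1..<2 * n}" "x k < x (k + 1)" "y = swap n k x"
    by (auto simp: ascents_def)
  then show "y \<in> upper_covers (Weak_B n) x"
    unfolding upper_covers_def mem_Collect_eq
    using covered_by_of_mirror_pair[OF x swap_mem[OF x k(1)]] inversions_swap_ascent[OF x k(1,2)] by metis
next
  fix y assume "y \<in> upper_covers (Weak_B n) x"
  then have y: "y \<in> B n" "inversions n x \<subset> inversions n y"
    "\<And>z. z \<in> B n \<Longrightarrow> inversions n x \<subset> inversions n z \<Longrightarrow> \<not> inversions n z \<subset> inversions n y"
    unfolding upper_covers_def covered_by_Weak_B by auto
  then obtain k where k: "k \<in> {1..<2 * n}" "inv y (x (k + 1)) < inv y (x k)"
    using adjacent_disagreement[OF x, of y] by blast
  have mem: "x k \<in> {1..2 * n}" "x (k + 1) \<in> {1..2 * n}"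
    using k(1) B_mem[OF x, of k] B_mem[OF x, of "k + 1"] by auto
  have "\<not> x (k + 1) < x k"
  proof
    assume "x (k + 1) < x k"
    then have "(x (k + 1), x k) \<in> inversions n x" using mem x by (simp add: inversions_iff)
    then have "(x (k + 1), x k) \<in> inversions n y" using y(2) by blast
    then show False using k(2) inversions_iff[OF y(1)] by auto
  qed
  moreover have "x k \<noteq> x (k + 1)" using x by (simp add: B_eq_iff)
  ultimately have asc: "x k < x (k + 1)" by linarith
  note swap = inversions_swap_ascent[OF x k(1) asc] swap_mem[OF x k(1)]
  have "(x k, x (k + 1)) \<in> inversions n y" using k(2) asc mem inversions_iff[OF y(1)] by blast
  then have "inversions n (swap n k x) \<subseteq> inversions n y"
    using swap(1) y(2) inversions_bar[OF y(1)] by blast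
  moreover have "inversions n x \<subset> inversions n (swap n k x)" using swap(1,2) by blast
  ultimately have "inversions n y = inversions n (swap n k x)" using y(3)[OF swap(3)] by blast
  then have "y = swap n k x" by (rule inversions_inject[OF y(1) swap(3)])
  then show "y \<in> (\<lambda>k. swap n k x) ` ascents n x" using k(1) asc by (auto simp: ascents_def)
qed

text \<open>Mirror positions yield the same exchange, so the ascents in the first half produce all
  upper covers. They yield distinct ones because each adds its own adjacent pair as an
  inversion.\<close>

lemma card_upper_covers_Weak_B:
  assumes x: "x \<in> B n" and n: "n \<ge> 1"
  shows "card (upper_covers (Weak_B n) x) = card {k \<in> {1..n}. x k < x (k + 1)}"
proof -
  let ?A = "{k \<in> {1..n}. x k < x (k + 1)}"
  have A: "?A \<subseteq> ascents n x" using n by (auto simp: ascents_def)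
  have cover: "ascents n x \<subseteq> ?A \<union> (\<lambda>k. 2 * n - k) ` ?A"
  proof
    fix k assume k: "k \<in> ascents n x"
    then have k': "k \<in> {1..<2 * n}" "k \<notin> descents n x" using ascents_conv_descents[OF x] by auto
    show "k \<in> ?A \<union> (\<lambda>k. 2 * n - k) ` ?A"
    proof (cases "k \<le> n")
      case True then show ?thesis using k by (auto simp: ascents_def)
    next
      case False
      have "2 * n - k \<in> {1..<2 * n}" using k' by auto
      moreover have "2 * n - k \<notin> descents n x"
        using k' mirror_symmetric_descents[OF x] by (auto simp: mirror_symmetric_def)
      ultimately have "2 * n - k \<in> ascents n x" using ascents_conv_descents[OF x] by auto
      then have "2 * n - k \<in> ?A" using False by (auto simp: ascents_def)
      moreover have "k = 2 * n - (2 * n - k)" using k' by auto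
      ultimately show ?thesis by blast
    qed
  qed
  have swap_mirror: "swap n (2 * n - k) x = swap n k x" if "k \<in> ?A" for k
  proof -
    have "{2 * n - k, 2 * n - (2 * n - k)} = {k, 2 * n - k}" using that n by auto
    then show ?thesis by simp
  qed
  have "(\<lambda>k. swap n k x) ` ascents n x = (\<lambda>k. swap n k x) ` ?A"
  proof (intro equalityI image_mono[OF A] image_subsetI)
    fix k assume "k \<in> ascents n x"
    then consider "k \<in> ?A" | l where "l \<in> ?A" "k = 2 * n - l" using cover by blast
    then show "swap n k x \<in> (\<lambda>k. swap n k x) ` ?A"
    proof cases
      case 2
      then show ?thesis using swap_mirror by (intro image_eqI[where x = l]) simp_all
    qed blast
  qed
  moreover have "inj_on (\<lambda>k. swap n k x) ?A"
  proof (rule inj_onI)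
    fix k l assume k: "k \<in> ?A" and l: "l \<in> ?A" and eq: "swap n k x = swap n l x"
    have kl: "k \<in> {1..<2 * n}" "x k < x (k + 1)" "l \<in> {1..<2 * n}" "x l < x (l + 1)"
      using k l n by auto
    note k' = inversions_swap_ascent[OF x kl(1,2)]
    note l' = inversions_swap_ascent[OF x kl(3,4)]
    have "(x k, x (k + 1)) \<in> inversions n (swap n l x)"
      unfolding eq[symmetric] k'(1) by (intro UnI2 insertI1)
    then have "(x k, x (k + 1)) \<in> {(x l, x (l + 1)), (x (2 * n - l), x (2 * n - l + 1))}"
      unfolding l'(1) bar_step[OF x kl(3)] using k'(2) by (elim UnE) simp_all
    \<comment> \<open>Both positions are at most n, so the mirror alternative forces
      \<open>k = l = n\<close>.\<close>
    then have "k = l \<or> k = 2 * n - l" using B_eq_iff[OF x] by blast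
    then show "k = l" using k l by auto
  qed
  ultimately show ?thesis
    using upper_covers_Weak_B[OF x] by (simp add: card_image)
qed

text \<open>Each lower bound of x and its lower covers lists the entries at every descent of x in
  increasing order. By transitivity it undoes every inversion inside a descending run, and the
  reversal of all runs is the greatest such element.\<close>

lemma Pop_Weak_B:
  assumes x: "x \<in> B n"
  shows "Pop (Weak_B n) x = flip n (descents n x) x"
proof -
  let ?M = "Weak_B n" and ?D = "descents n x"
  let ?L = "Lower ?M (insert x (lower_covers ?M x))"
  define p where "p = flip n ?D x"
  have p: "p \<in> B n" unfolding p_def by (intro flip_mem mirror_symmetric_descents x)
  have p_iff: "(a, b) \<in> inversions n p \<longleftrightarrow>
      (a, b) \<in> inversions n x \<and> \<not> {inv x b..<inv x a} \<subseteq> ?D" for a b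
    unfolding p_def
    by (rule flip_descending[OF x mirror_symmetric_descents[OF x]]) (simp add: descents_def)
  have L_iff: "z \<in> ?L \<longleftrightarrow> z \<in> B n \<and> inversions n z \<subseteq> inversions n x \<and>
      (\<forall>k\<in>?D. inversions n z \<subseteq> inversions n (swap n k x))" for z
  proof -
    have "swap n k x \<in> B n" if "k \<in> ?D" for k using that swap_mem[OF x] by (auto simp: descents_def)
    then show ?thesis using x by (auto simp: Lower_def lower_covers_Weak_B[OF x] le_Weak_B)
  qed
  have "p \<in> ?L"
  proof -
    have "(a, b) \<in> inversions n (swap n k x)" if k: "k \<in> ?D" and ab: "(a, b) \<in> inversions n p" for k a b
    proof -
      have k': "k \<in> {1..<2 * n}" using k by (auto simp: descents_def)
      have sub: "{k, 2 * n - k} \<subseteq> ?D"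
        using k k' mirror_symmetric_descents[OF x] by (auto simp: mirror_symmetric_def)
      show ?thesis
        using p_iff[of a b] ab sub
        by (subst flip_descending[OF x mirror_symmetric_pair[OF k']]) (auto simp: descents_def)
    qed
    then show ?thesis using L_iff p p_iff by auto
  qed
  moreover have "inversions n z \<subseteq> inversions n p" if "z \<in> ?L" for z
  proof (rule subrelI)
    have z: "z \<in> B n" "inversions n z \<subseteq> inversions n x"
      "\<And>k. k \<in> ?D \<Longrightarrow> inversions n z \<subseteq> inversions n (swap n k x)"
      using that L_iff by auto
    \<comment> \<open>Lying below the exchange at k keeps the descent pair out of the inversions of
      z.\<close>
    have step: "inv z (x (k + 1)) < inv z (x k)" if k: "k \<in> ?D" for k
    proof -
      have k': "k \<in> {1..<2 * n}" "x (k + 1) < x k" using k by (auto simp: descents_def)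
      have "x k \<in> {1..2 * n}" "x (k + 1) \<in> {1..2 * n}"
        using k'(1) B_mem[OF x, of k] B_mem[OF x, of "k + 1"] by auto
      moreover have "(x (k + 1), x k) \<notin> inversions n z"
        using z(3)[OF k] inversions_swap_descent(2)[OF x k'] by blast
      ultimately have "\<not> inv z (x k) < inv z (x (k + 1))"
        using k'(2) inversions_iff[OF z(1)] by blast
      moreover have "inv z (x k) \<noteq> inv z (x (k + 1))" using x z(1) by (simp add: B_inv_eq_iff B_eq_iff)
      ultimately show ?thesis by linarith
    qed
    fix a b assume ab: "(a, b) \<in> inversions n z"
    have "\<not> {inv x b..<inv x a} \<subseteq> ?D"
    proof
      assume sub: "{inv x b..<inv x a} \<subseteq> ?D"
      have "(a, b) \<in> inversions n x" using ab z(2) by blast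
      then have "inv x b < inv x a" using inversions_iff[OF x] by blast
      then have "inv z (x (inv x a)) < inv z (x (inv x b))"
        using greater_of_step_greater[of "inv x b" "inv x a" "\<lambda>k. inv z (x k)"] step sub by blast
      then show False using ab x inversions_iff[OF z(1)] by simp
    qed
    then show "(a, b) \<in> inversions n p" using p_iff ab z(2) by blast
  qed
  moreover have "?L \<subseteq> B n" using L_iff by blast
  ultimately have "greatest ?M p ?L" by (auto simp: greatest_def)
  \<comment> \<open>The meet is defined by choice of a greatest lower bound, so its uniqueness is
    what identifies it with p.\<close>
  moreover have "q = p" if "greatest ?M q ?L" for q
  proof (rule inversions_inject)
    show "q \<in> B n" "p \<in> B n" using that p by (auto simp: greatest_def)
    show "inversions n q = inversions n p"
      using that calculation by (auto simp: greatest_def)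
  qed
  ultimately show ?thesis
    unfolding Pop_def Lattice.inf_def p_def[symmetric] by (rule some_equality)
qed

section \<open>Signed permutations with a single descent\<close>

lemma initial_segment_eq:
  fixes S :: "nat set"
  assumes "S \<subseteq> {1..N}" "\<And>s t. s \<in> S \<Longrightarrow> t \<in> {1..N} - S \<Longrightarrow> s < t"
  shows "S = {1..card S}"
proof (cases "S = {}")
  case False
  have fin: "finite S" using assms(1) finite_subset by blast
  have max: "Max S \<in> S" using fin False by simp
  have "S = {1..Max S}"
  proof (intro equalityI subsetI)
    fix s assume "s \<in> S"
    then show "s \<in> {1..Max S}" using fin assms(1) by auto
  next
    fix t assume t: "t \<in> {1..Max S}"
    then have "t \<in> {1..N}" using max assms(1) by auto
    then show "t \<in> S" using assms(2)[OF max, of t] t by fastforce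
  qed
  then have "card S = Max S" by (metis card_atLeastAtMost diff_Suc_1)
  then show ?thesis using \<open>S = {1..Max S}\<close> by simp
qed simp

text \<open>The complement is an initial segment.\<close>

lemma final_segment_eq:
  fixes S :: "nat set"
  assumes S: "S \<subseteq> {1..N}" and less: "\<And>s t. s \<in> S \<Longrightarrow> t \<in> {1..N} - S \<Longrightarrow> t < s"
  shows "S = {N + 1 - card S..N}"
proof -
  have "card ({1..N} - S) = N - card S"
    using S by (simp add: card_Diff_subset finite_subset)
  moreover have "{1..N} - S = {1..card ({1..N} - S)}"
    using less by (intro initial_segment_eq[of _ N]) auto
  ultimately have compl: "{1..N} - S = {1..N - card S}" by simp
  have "S = {1..N} - ({1..N} - S)" using S by blast
  also have "\<dots> = {1..N} - {1..N - card S}" by (simp only: compl)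
  also have "\<dots> = {N + 1 - card S..N}" using card_mono[OF _ S] by auto
  finally show ?thesis .
qed

text \<open>These are the faces, including the empty one, of the cross-polytope with vertices
  \<open>{1..2 * n}\<close> in which v and \<open>bar n v\<close> are opposite.\<close>

definition signed_set :: "nat \<Rightarrow> nat set \<Rightarrow> bool" where
  "signed_set n A \<longleftrightarrow> A \<subseteq> {1..2 * n} \<and> (\<forall>a\<in>A. bar n a \<notin> A)"

text \<open>A and its mirror image are disjoint sets of the same size inside
  \<open>{1..2 * n}\<close>.\<close>

lemma card_signed_set_le:
  assumes A: "signed_set n A"
  shows "card A \<le> n"
proof -
  have sub: "A \<subseteq> {1..2 * n}" using A by (simp add: signed_set_def)
  then have "inj_on (bar n) A" by (intro inj_onI) (auto dest!: subsetD)
  moreover have "A \<inter> bar n ` A = {}" using A by (auto simp: signed_set_def)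
  ultimately have "card (A \<union> bar n ` A) = 2 * card A"
    using finite_subset[OF sub] by (simp add: card_Un_disjoint card_image)
  moreover have "A \<union> bar n ` A \<subseteq> {1..2 * n}" using sub bar_mem by blast
  ultimately show ?thesis using card_mono[of "{1..2 * n}" "A \<union> bar n ` A"] by simp
qed

text \<open>The index of the block (first \<open>d\<close>, middle, last \<open>d\<close> positions) that holds the value \<open>v\<close> in
  a word whose first \<open>d\<close> values form \<open>A\<close>.\<close>

definition block :: "nat \<Rightarrow> nat set \<Rightarrow> nat \<Rightarrow> nat" where
  "block n A v = (if v \<in> A then 0 else if bar n v \<in> A then 2 else 1)"

text \<open>Positions up to n suffice, since the later ones mirror them. For \<open>d = n\<close>
  the middle block is empty.\<close>

definition single_descent :: "nat \<Rightarrow> (nat \<Rightarrow> nat) \<Rightarrow> nat \<Rightarrow> bool" where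
  "single_descent n w d \<longleftrightarrow> d \<in> {1..n} \<and> (\<forall>k\<in>{1..n}. w (k + 1) < w k \<longleftrightarrow> k = d)"

text \<open>The positions in \<open>{1..n}\<close> split into ascents and descents, so
  \<open>n - 1\<close> ascents leave one descent.\<close>

lemma card_ascents_eq_iff:
  assumes w: "w \<in> B n" and n: "n \<ge> 1"
  shows "card {k \<in> {1..n}. w k < w (k + 1)} = n - 1 \<longleftrightarrow> (\<exists>d. single_descent n w d)"
proof -
  let ?A = "{k \<in> {1..n}. w k < w (k + 1)}" and ?D = "{k \<in> {1..n}. w (k + 1) < w k}"
  have "w k \<noteq> w (k + 1)" for k using w by (simp add: B_eq_iff)
  then have "?A \<union> ?D = {1..n}" by (auto simp: neq_iff)
  moreover have "card (?A \<union> ?D) = card ?A + card ?D"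
    by (rule card_Un_disjoint) auto
  ultimately have "card ?A + card ?D = n" by simp
  then have "card ?A = n - 1 \<longleftrightarrow> card ?D = 1" using n by linarith
  also have "\<dots> \<longleftrightarrow> (\<exists>d. ?D = {d})" by (rule card_1_singleton_iff[unfolded One_nat_def[symmetric]])
  also have "\<dots> \<longleftrightarrow> (\<exists>d. single_descent n w d)"
    unfolding single_descent_def by (intro ex_cong1) blast
  finally show ?thesis .
qed

section \<open>Words with a single descent and their prefixes\<close>

lemma mem_prefix_iff:
  assumes "w \<in> B n" "1 \<le> i"
  shows "w i \<in> w ` {1..d} \<longleftrightarrow> i \<le> d"
  using assms B_eq_iff[OF assms(1)] by (auto simp: image_iff)

lemma block_prefix:
  assumes w: "w \<in> B n" and d: "d \<le> n" and i: "i \<in> {1..2 * n}"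
  shows "block n (w ` {1..d}) (w i) = (if i \<le> d then 0 else if i \<le> 2 * n - d then 1 else 2)"
proof -
  have "bar n (w i) = w (bar n i)" using B_bar[OF w i] by simp
  moreover have "w (bar n i) \<in> w ` {1..d} \<longleftrightarrow> bar n i \<le> d"
    using i by (intro mem_prefix_iff[OF w]) auto
  moreover have "w i \<in> w ` {1..d} \<longleftrightarrow> i \<le> d"
    using i by (intro mem_prefix_iff[OF w]) auto
  ultimately show ?thesis unfolding block_def using d i by auto
qed

lemma signed_set_prefix:
  assumes w: "w \<in> B n" and d: "d \<le> n"
  shows "signed_set n (w ` {1..d})"
  unfolding signed_set_def
proof (intro conjI ballI)
  show "w ` {1..d} \<subseteq> {1..2 * n}" using B_mem[OF w] d by fastforce
  fix a assume "a \<in> w ` {1..d}"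
  then obtain i where i: "i \<in> {1..d}" "a = w i" by blast
  then have i': "i \<in> {1..2 * n}" using d by auto
  have "bar n i > d" using i d by auto
  then show "bar n a \<notin> w ` {1..d}"
    unfolding i(2) B_bar[OF w i', symmetric] using mem_prefix_iff[OF w, of "bar n i" d] by linarith
qed

lemma single_descent_step_less:
  assumes w: "w \<in> B n" and sd: "single_descent n w d"
    and k: "k \<in> {1..<2 * n}" "k \<noteq> d" "k \<noteq> 2 * n - d"
  shows "w k < w (k + 1)"
proof -
  have "\<not> w (k + 1) < w k"
  proof (cases "k \<le> n")
    case True
    then show ?thesis using sd k unfolding single_descent_def by auto
  next
    case False
    then have "2 * n - k \<in> {1..n}" "2 * n - k \<noteq> d" using k sd by (auto simp: single_descent_def)
    then have "\<not> w (2 * n - k + 1) < w (2 * n - k)" using sd unfolding single_descent_def by blast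
    then show ?thesis using descent_mirror[OF w k(1)] by blast
  qed
  moreover have "w k \<noteq> w (k + 1)" using w by (simp add: B_eq_iff)
  ultimately show ?thesis by linarith
qed

text \<open>The word increases inside each block, so only pairs in different blocks are inverted.
  The right-hand side depends on A alone, hence so does w; this gives injectivity in the final
  count.\<close>

lemma inversions_single_descent:
  assumes w: "w \<in> B n" and sd: "single_descent n w d"
  defines "A \<equiv> w ` {1..d}"
  shows "inversions n w = {(a, b). a \<in> {1..2 * n} \<and> b \<in> {1..2 * n} \<and> a < b \<and> block n A b < block n A a}"
proof -
  have d: "d \<le> n" using sd by (simp add: single_descent_def)
  have less: "w i < w j"
    if ij: "i \<in> {1..2 * n}" "j \<in> {1..2 * n}" "i < j" "block n A (w i) = block n A (w j)" for i j
  proof (rule less_of_step_less[OF ij(3)])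
    fix k assume "k \<in> {i..<j}"
    \<comment> \<open>With both ends in one block, k avoids d and \<open>2 * n - d\<close>, the only
      places where w can descend.\<close>
    then show "w k < w (k + 1)"
      using ij(1,2,4) d unfolding A_def block_prefix[OF w d ij(1)] block_prefix[OF w d ij(2)]
      by (intro single_descent_step_less[OF w sd]) (auto split: if_splits)
  qed
  have "inv w b < inv w a \<longleftrightarrow> block n A b < block n A a"
    if ab: "a \<in> {1..2 * n}" "b \<in> {1..2 * n}" "a < b" for a b
  proof -
    have mem: "inv w a \<in> {1..2 * n}" "inv w b \<in> {1..2 * n}" using ab B_inv_mem[OF w] by auto
    have "inv w a \<noteq> inv w b" using ab w by (simp add: B_inv_eq_iff)
    moreover have "block n A a \<noteq> block n A b" if "inv w b < inv w a"
      using less[OF mem(2,1) that] ab w by auto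
    ultimately show ?thesis
      using block_prefix[OF w d mem(1)] block_prefix[OF w d mem(2)] w d
      unfolding A_def by (auto split: if_splits)
  qed
  then show ?thesis using inversions_iff[OF w] by auto
qed

text \<open>If the prefix lay entirely above its complement, w would invert every pair across the
  border, including one that the reversal of runs must have undone.\<close>

lemma Pop_image_overlap:
  assumes x: "x \<in> B n" and w: "w = Pop (Weak_B n) x" and d: "d \<in> {1..n}"
  shows "\<exists>a\<in>w ` {1..d}. \<exists>c\<in>{1..2 * n} - w ` {1..d}. a < c"
proof (rule ccontr)
  let ?A = "w ` {1..d}"
  assume "\<not> ?thesis"
  then have ge: "c \<le> a" if "a \<in> ?A" "c \<in> {1..2 * n} - ?A" for a c
    using that by (meson not_less)
  have w_flip: "w = flip n (descents n x) x" using w Pop_Weak_B[OF x] by simp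
  have wB: "w \<in> B n" unfolding w_flip by (intro flip_mem x mirror_symmetric_descents)
  have w_iff: "(a, b) \<in> inversions n w \<longleftrightarrow>
      (a, b) \<in> inversions n x \<and> \<not> {inv x b..<inv x a} \<subseteq> descents n x" for a b
    unfolding w_flip
    by (rule flip_descending[OF x mirror_symmetric_descents[OF x]]) (simp add: descents_def)
  have A: "?A \<subseteq> {1..2 * n}" using signed_set_prefix[OF wB, of d] d by (simp add: signed_set_def)
  have inv_w: "(c, a) \<in> inversions n w" if a: "a \<in> ?A" and c: "c \<in> {1..2 * n} - ?A" for a c
  proof -
    have "c \<noteq> a" using a c by blast
    then have "c < a" using ge[OF a c] by simp
    moreover have "inv w a \<le> d" using a wB by auto
    moreover have "d < inv w c"
    proof (rule ccontr)
      assume "\<not> d < inv w c"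
      then have "inv w c \<in> {1..d}" using B_inv_mem[OF wB, of c] c by auto
      then have "w (inv w c) \<in> ?A" by (rule imageI)
      then show False using c wB by simp
    qed
    ultimately show ?thesis using a c A by (auto simp: inversions_iff[OF wB])
  qed
  \<comment> \<open>All inversions across the border are inherited by x, so x too lists the values
    of \<open>?A\<close> before all others.\<close>
  have "inv x ` ?A = {1..card (inv x ` ?A)}"
  proof (rule initial_segment_eq[of _ "2 * n"])
    show "inv x ` ?A \<subseteq> {1..2 * n}" using A B_inv_mem[OF x] by blast
    fix s t assume "s \<in> inv x ` ?A" and t: "t \<in> {1..2 * n} - inv x ` ?A"
    then obtain a where a: "a \<in> ?A" "s = inv x a" by blast
    have "x t \<in> {1..2 * n} - ?A"
    proof
      show "x t \<in> {1..2 * n}" using t B_mem[OF x] by blast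
      show "x t \<notin> ?A"
      proof
        assume "x t \<in> ?A"
        then have "inv x (x t) \<in> inv x ` ?A" by (rule imageI)
        then show False using t x by simp
      qed
    qed
    then have "(x t, a) \<in> inversions n x" using inv_w[OF a(1)] w_iff by blast
    then show "s < t" using inversions_iff[OF x] a(2) x by auto
  qed
  moreover have "card (inv x ` ?A) = d"
  proof -
    have "inj_on (inv x) ?A" "inj_on w {1..d}"
      using B_inv_eq_iff[OF x] B_eq_iff[OF wB] by (auto intro: inj_onI)
    then show ?thesis by (simp add: card_image)
  qed
  ultimately have prefix: "inv x ` ?A = {1..d}" by simp
  have x_mem: "x i \<in> ?A \<longleftrightarrow> i \<in> {1..d}" for i
  proof -
    have "x i \<in> ?A \<longleftrightarrow> inv x (x i) \<in> inv x ` ?A"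
      using B_inv_eq_iff[OF x] by (auto simp only: image_iff)
    then show ?thesis using prefix x by simp
  qed
  \<comment> \<open>The entries of x at d and \<open>d + 1\<close> straddle the border, so they form
    a descent of x that remains inverted in w; but the flip removes the inversion at every
    descent.\<close>
  have "x d \<in> ?A" "x (d + 1) \<in> {1..2 * n} - ?A"
    using x_mem[of d] x_mem[of "d + 1"] d B_mem[OF x, of "d + 1"] by auto
  then have "(x (d + 1), x d) \<in> inversions n w" by (rule inv_w)
  then have "x (d + 1) < x d" "\<not> {d..<d + 1} \<subseteq> descents n x"
    using w_iff x inversions_iff[OF x] by auto
  then show False using d by (auto simp: descents_def)
qed

section \<open>Realising a signed set as the prefix of an element in the image of Pop\<close>

lemma block_mirror:
  assumes "signed_set n A" "v \<in> {1..2 * n}"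
  shows "block n A v + block n A (bar n v) = 2"
proof -
  have "bar n (bar n v) = v" using assms(2) by auto
  then show ?thesis using assms(1) unfolding block_def signed_set_def by auto
qed

text \<open>The block index is the leading key and f breaks ties. Both the identity and
  \<open>bar n\<close> qualify as f, giving increasing and decreasing blocks respectively.\<close>

lemma B_sorted_by_block_exists:
  assumes A: "signed_set n A" and inj: "inj_on f {1..2 * n}"
    and f: "\<And>v. v \<in> {1..2 * n} \<Longrightarrow> f v \<in> {1..2 * n} \<and> f v + f (bar n v) = 2 * n + 1"
  shows "\<exists>w\<in>B n. \<forall>u\<in>{1..2 * n}. \<forall>v\<in>{1..2 * n}. inv w u < inv w v \<longleftrightarrow>
    block n A u < block n A v \<or> block n A u = block n A v \<and> f u < f v"
proof -
  let ?I = "{1..2 * n}" and ?K = "2 * n + 1"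
  define key where "key v = block n A v * ?K + f v" for v
  have less: "key u < key v" if "u \<in> ?I" "block n A u < block n A v" for u v
  proof -
    have "(block n A u + 1) * ?K \<le> block n A v * ?K"
      using that(2) by (intro mult_le_mono1) simp
    moreover have "f u < ?K" using f[OF that(1)] by auto
    moreover have "p + f u < q + f v" if "p + 1 * K \<le> q" "f u < K" for p q K
      using that by simp
    ultimately show ?thesis unfolding key_def add_mult_distrib by blast
  qed
  have key_iff: "key u < key v \<longleftrightarrow>
      block n A u < block n A v \<or> block n A u = block n A v \<and> f u < f v"
    if "u \<in> ?I" "v \<in> ?I" for u v
    using less[OF that(1), of v] less[OF that(2), of u]
    by (cases "block n A u" "block n A v" rule: linorder_cases) (auto simp: key_def)
  have "inj_on key ?I"
  proof (rule inj_onI)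
    fix u v assume uv: "u \<in> ?I" "v \<in> ?I" "key u = key v"
    then have "f u = f v" using key_iff[OF uv(1,2)] key_iff[OF uv(2,1)] by force
    then show "u = v" by (rule inj_onD[OF inj _ uv(1,2)])
  qed
  \<comment> \<open>Mirror block indices add up to 2, and f contributes one more
    \<open>?K\<close>.\<close>
  moreover have "key v + key (bar n v) = 3 * ?K" if v: "v \<in> ?I" for v
  proof -
    have "key v + key (bar n v) = (block n A v + block n A (bar n v)) * ?K + (f v + f (bar n v))"
      unfolding key_def by (simp only: add_mult_distrib)
    then show ?thesis using block_mirror[OF A v] f[OF v] by simp
  qed
  ultimately obtain w where "w \<in> B n"
    and "\<And>u v. u \<in> ?I \<Longrightarrow> v \<in> ?I \<Longrightarrow> inv w u < inv w v \<longleftrightarrow> key u < key v"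
    using B_sorted_by_key_exists[of key n] by blast
  then show ?thesis using key_iff by blast
qed

text \<open>Take w with increasing blocks and x with decreasing blocks on the same sets of values.
  Reversing the descending runs of x yields w provided that no run of x crosses a block
  border.\<close>

lemma Pop_image_of_signed_set:
  assumes A: "signed_set n A" and ne: "A \<noteq> {}" "A \<noteq> {1..card A}" "A \<noteq> {2 * n + 1 - card A..2 * n}"
  shows "\<exists>w\<in>Pop (Weak_B n) ` B n. single_descent n w (card A) \<and> w ` {1..card A} = A"
proof -
  let ?I = "{1..2 * n}" and ?bl = "block n A"
  define d where "d = card A"
  have sub: "A \<subseteq> ?I" and bar_A: "\<And>a. a \<in> A \<Longrightarrow> bar n a \<notin> A"
    using A by (auto simp: signed_set_def)
  have fin: "finite A" using sub finite_subset by blast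
  have "0 < d" using ne(1) fin by (simp add: d_def card_gt_0_iff)
  then have d: "d \<in> {1..n}" using card_signed_set_le[OF A] by (simp add: d_def)
  have bl_0: "?bl v = 0 \<longleftrightarrow> v \<in> A" and bl_le: "?bl v \<le> 2" if "v \<in> ?I" for v
    using bar_A[of v] by (auto simp: block_def)
  obtain w where w: "w \<in> B n" and w_less: "\<And>u v. u \<in> ?I \<Longrightarrow> v \<in> ?I \<Longrightarrow>
      inv w u < inv w v \<longleftrightarrow> ?bl u < ?bl v \<or> ?bl u = ?bl v \<and> u < v"
  proof -
    have "\<exists>w\<in>B n. \<forall>u\<in>?I. \<forall>v\<in>?I. inv w u < inv w v \<longleftrightarrow>
        ?bl u < ?bl v \<or> ?bl u = ?bl v \<and> u < v"
      by (rule B_sorted_by_block_exists[OF A]) auto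
    then show ?thesis using that by blast
  qed
  obtain x where x: "x \<in> B n" and x_less: "\<And>u v. u \<in> ?I \<Longrightarrow> v \<in> ?I \<Longrightarrow>
      inv x u < inv x v \<longleftrightarrow> ?bl u < ?bl v \<or> ?bl u = ?bl v \<and> bar n u < bar n v"
  proof -
    have "\<exists>w\<in>B n. \<forall>u\<in>?I. \<forall>v\<in>?I. inv w u < inv w v \<longleftrightarrow>
        ?bl u < ?bl v \<or> ?bl u = ?bl v \<and> bar n u < bar n v"
      by (rule B_sorted_by_block_exists[OF A]) (auto simp: inj_on_def)
    then show ?thesis using that by blast
  qed
  have x_mono: "?bl (x i) \<le> ?bl (x j)" if "i \<in> ?I" "j \<in> ?I" "i \<le> j" for i j
    using x_less[OF B_mem[OF x that(1)] B_mem[OF x that(2)]] that(3) x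
    by (cases "i = j") auto
  txt \<open>The last entry of a block of \<open>x\<close> is its minimum and the first entry of the next block its
    maximum; if they formed a descent, all of \<open>A\<close> would lie above its complement.\<close>
  have jump: "x k < x (k + 1)" if k: "k \<in> {1..<2 * n}" and bl: "?bl (x k) < ?bl (x (k + 1))" for k
  proof (rule ccontr)
    assume "\<not> x k < x (k + 1)"
    define u v where "u = x k" and "v = x (k + 1)"
    have k': "k \<in> ?I" "k + 1 \<in> ?I" using k by auto
    have uv: "u \<in> ?I" "v \<in> ?I" "v < u" "?bl u < ?bl v"
      using \<open>\<not> x k < x (k + 1)\<close> B_mem[OF x k'(1)] B_mem[OF x k'(2)] bl B_eq_iff[OF x, of k "k + 1"]
      unfolding u_def v_def by auto
    \<comment> \<open>The values u and v are adjacent in x. Hence u is the minimum of its block, v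
      the maximum of its own, and no value lies in a block strictly between.\<close>
    have between: "\<not> (inv x u < inv x t \<and> inv x t < inv x v)" for t
      using x by (simp add: u_def v_def)
    have min: "u \<le> t" if "t \<in> ?I" "?bl t = ?bl u" for t
      using between[of t] x_less[OF uv(1) that(1)] x_less[OF that(1) uv(2)] that uv by fastforce
    have max: "t \<le> v" if "t \<in> ?I" "?bl t = ?bl v" for t
      using between[of t] x_less[OF uv(1) that(1)] x_less[OF that(1) uv(2)] that uv by fastforce
    have none: "\<not> (?bl u < ?bl t \<and> ?bl t < ?bl v)" if "t \<in> ?I" for t
      using between[of t] x_less[OF uv(1) that(1)] x_less[OF that(1) uv(2)] by blast
    have mirror: "?bl t + ?bl (bar n t) = 2" if "t \<in> ?I" for t by (rule block_mirror[OF A that])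
    have "c < a" if a: "a \<in> A" and c: "c \<in> ?I - A" for a c
    proof -
      have aI: "a \<in> ?I" "bar n a \<in> ?I" and cI: "c \<in> ?I" "bar n c \<in> ?I"
        and ubI: "bar n u \<in> ?I" "bar n v \<in> ?I"
        using a c sub uv bar_mem by blast+
      have bl_a: "?bl a = 0" "?bl (bar n a) = 2" using a bl_0[OF aI(1)] mirror[OF aI(1)] by auto
      have bl_c: "?bl c = 1 \<or> ?bl c = 2" using c bl_0[OF cI(1)] bl_le[OF cI(1)] by auto
      \<comment> \<open>In the second case the middle block is empty. The first and third cases are
        mirror images: the middle block is closed under \<open>bar n\<close>, which bounds the
        mirror of its extreme value, and a value c in the last block is handled through
        \<open>bar n c\<close> in the first.\<close>
      consider "?bl u = 0" "?bl v = 1" | "?bl u = 0" "?bl v = 2" | "?bl u = 1" "?bl v = 2"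
        using uv(4) bl_le[OF uv(2)] by linarith
      then show ?thesis
      proof cases
        case 1
        then have "u \<le> a" "bar n v \<le> v"
          using min[OF aI(1)] max[OF ubI(2)] bl_a mirror[OF uv(2)] by auto
        moreover have "c \<le> v \<or> u \<le> bar n c"
          using bl_c max[OF cI(1)] min[OF cI(2)] 1 mirror[OF cI(1)] by auto
        ultimately show ?thesis using uv(1-3) cI by auto
      next
        case 2
        then have "u \<le> a" "c \<le> v"
          using min[OF aI(1)] max[OF cI(1)] none[OF cI(1)] bl_a bl_c by auto
        then show ?thesis using uv(3) by simp
      next
        case 3
        then have "bar n a \<le> v" "u \<le> bar n u"
          using max[OF aI(2)] min[OF ubI(1)] bl_a mirror[OF uv(1)] by auto
        moreover have "c \<le> v \<or> u \<le> bar n c"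
          using bl_c max[OF cI(1)] min[OF cI(2)] 3 mirror[OF cI(1)] by auto
        ultimately show ?thesis using uv(1-3) cI aI by auto
      qed
    qed
    then have "A = {2 * n + 1 - card A..2 * n}" by (intro final_segment_eq[OF sub])
    then show False using ne(3) by simp
  qed
  have "Pop (Weak_B n) x = w"
  proof (rule inversions_inject)
    let ?p = "flip n (descents n x) x"
    show "w \<in> B n" "Pop (Weak_B n) x \<in> B n"
      using w flip_mem[OF x mirror_symmetric_descents[OF x]] Pop_Weak_B[OF x] by auto
    have "(a, b) \<in> inversions n ?p \<longleftrightarrow> (a, b) \<in> inversions n w" for a b
    proof (cases "a < b \<and> a \<in> ?I \<and> b \<in> ?I")
      case True
      define i j where "i = inv x b" and "j = inv x a"
      have ij: "i \<in> ?I" "j \<in> ?I" "x i = b" "x j = a"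
        using True x B_inv_mem[OF x] by (auto simp: i_def j_def)
      have x_iff: "(a, b) \<in> inversions n x \<longleftrightarrow> ?bl b < ?bl a \<or> ?bl b = ?bl a"
        using True x_less[of b a] inversions_iff[OF x, of a b] by auto
      have w_iff: "(a, b) \<in> inversions n w \<longleftrightarrow> ?bl b < ?bl a"
        using True w_less[of b a] inversions_iff[OF w, of a b] by auto
      have p_iff: "(a, b) \<in> inversions n ?p \<longleftrightarrow>
          (a, b) \<in> inversions n x \<and> \<not> {i..<j} \<subseteq> descents n x"
        unfolding i_def j_def
        by (rule flip_descending[OF x mirror_symmetric_descents[OF x]]) (simp add: descents_def)
      show ?thesis
      proof (cases "?bl b \<le> ?bl a")
        case False
        then show ?thesis using p_iff x_iff w_iff by auto
      next
        case le: True
        then have "i < j" using x_iff True inversions_iff[OF x, of a b] by (auto simp: i_def j_def)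
        \<comment> \<open>By \<open>jump\<close> no descent of x crosses a block border, and x
          decreases inside each block, so the descending runs of x are precisely its blocks.\<close>
        have "{i..<j} \<subseteq> descents n x \<longleftrightarrow> ?bl b = ?bl a"
        proof
          assume run: "{i..<j} \<subseteq> descents n x"
          have "?bl (x m) = ?bl (x i)" if "i \<le> m" "m \<le> j" for m
            using that
          proof (induction m rule: dec_induct)
            case (step m)
            then have "m \<in> descents n x" using run by auto
            then have m: "m \<in> {1..<2 * n}" "x (m + 1) < x m" by (auto simp: descents_def)
            then have "\<not> ?bl (x m) < ?bl (x (m + 1))" using jump[OF m(1)] by auto
            moreover have "?bl (x m) \<le> ?bl (x (m + 1))" using m(1) by (intro x_mono) auto
            ultimately show ?case using step by simp
          qed simp
          from this[of j] show "?bl b = ?bl a" using \<open>i < j\<close> ij by simp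
        next
          assume eq: "?bl b = ?bl a"
          show "{i..<j} \<subseteq> descents n x"
          proof
            fix k assume k: "k \<in> {i..<j}"
            then have k': "k \<in> ?I" "k + 1 \<in> ?I" using ij(1,2) by auto
            have "?bl (x i) \<le> ?bl (x k)" "?bl (x k) \<le> ?bl (x (k + 1))" "?bl (x (k + 1)) \<le> ?bl (x j)"
              using k k' ij(1,2) by (auto intro!: x_mono)
            then have "?bl (x k) = ?bl (x (k + 1))" using eq ij(3,4) by simp
            then have "bar n (x k) < bar n (x (k + 1))"
              using x_less[OF B_mem[OF x k'(1)] B_mem[OF x k'(2)]] x by simp
            then show "k \<in> descents n x" using k' by (auto simp: descents_def)
          qed
        qed
        then show ?thesis using p_iff x_iff w_iff le by auto
      qed
    qed (auto simp: inversions_iff[OF w] inversions_iff[OF flip_mem[OF x mirror_symmetric_descents[OF x]]])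
    then show "inversions n (Pop (Weak_B n) x) = inversions n w"
      unfolding Pop_Weak_B[OF x] by auto
  qed
  then have image: "w \<in> Pop (Weak_B n) ` B n" using x by blast
  have prefix: "w ` {1..d} = A"
  proof -
    have "inv w ` A = {1..card (inv w ` A)}"
    proof (rule initial_segment_eq[of _ "2 * n"])
      show "inv w ` A \<subseteq> ?I" using sub B_inv_mem[OF w] by blast
      fix s t assume "s \<in> inv w ` A" and t: "t \<in> ?I - inv w ` A"
      then obtain a where a: "a \<in> A" "s = inv w a" by blast
      have "w t \<notin> A"
      proof
        assume "w t \<in> A"
        then have "inv w (w t) \<in> inv w ` A" by (rule imageI)
        then show False using t w by simp
      qed
      moreover have wt: "w t \<in> ?I" using t B_mem[OF w] by blast
      moreover have aI: "a \<in> ?I" using a sub by blast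
      ultimately have "?bl a < ?bl (w t)" using bl_0[OF aI] bl_0[OF wt] a(1) by simp
      then show "s < t" using w_less[OF aI wt] a(2) w by simp
    qed
    moreover have "card (inv w ` A) = d"
      unfolding d_def using B_inv_eq_iff[OF w] by (intro card_image inj_onI) auto
    ultimately have "w ` {1..d} = w ` inv w ` A" by simp
    then show ?thesis using w by (simp add: image_image)
  qed
  have step: "w k < w (k + 1)" if k: "k \<in> {1..n}" "k \<noteq> d" for k
  proof -
    have k': "k \<in> ?I" "k + 1 \<in> ?I" using k by auto
    have "?bl (w k) = ?bl (w (k + 1))"
      using block_prefix[OF w, of d k] block_prefix[OF w, of d "k + 1"] k k' d
      unfolding prefix by auto
    then show ?thesis using w_less[OF B_mem[OF w k'(1)] B_mem[OF w k'(2)]] w by simp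
  qed
  \<comment> \<open>Without a descent at d the word would increase on the first half and by
    mirroring everywhere. It would then be the identity, with the excluded prefix
    \<open>{1..d}\<close>.\<close>
  have "w (d + 1) < w d"
  proof (rule ccontr)
    assume "\<not> w (d + 1) < w d"
    then have "w d < w (d + 1)" using B_eq_iff[OF w, of d "d + 1"] by simp
    then have first_half: "w k < w (k + 1)" if "k \<in> {1..n}" for k
      using step[OF that] by (cases "k = d") auto
    have "w k < w (k + 1)" if k: "k \<in> {1..<2 * n}" for k
    proof (cases "k \<le> n")
      case True then show ?thesis using first_half k by simp
    next
      case False
      then have "2 * n - k \<in> {1..n}" using k by auto
      then have "w (2 * n - k) < w (2 * n - k + 1)" by (rule first_half)
      then have "\<not> w (k + 1) < w k" using descent_mirror[OF w k] by simp
      then show ?thesis using B_eq_iff[OF w, of k "k + 1"] by simp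
    qed
    then have "w = id" by (rule strict_mono_permutes_id[OF B_permutes[OF w]])
    then show False using prefix ne(2) by (simp add: d_def)
  qed
  then have "single_descent n w d"
    unfolding single_descent_def using d step by (metis less_asym)
  then show ?thesis using image prefix unfolding d_def by blast
qed

section \<open>Counting\<close>

text \<open>For each mirror pair there are three independent choices: the smaller value, the larger
  one, or neither. They are recorded by the block index of the smaller value.\<close>

lemma card_signed_sets: "card {A. signed_set n A} = 3 ^ n"
proof -
  define enc where "enc A = (\<lambda>i\<in>{1..n}. block n A i)" for A
  \<comment> \<open>The code 0 selects the smaller value of a pair and 2 the larger one.\<close>
  define dec where "dec f = {v \<in> {1..n}. f v = 0} \<union> {v \<in> {n + 1..2 * n}. f (bar n v) = 2}"
    for f :: "nat \<Rightarrow> nat"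
  have "bij_betw enc {A. signed_set n A} ({1..n} \<rightarrow>\<^sub>E {0, 1, 2})"
  proof (rule bij_betwI[where g = dec])
    show "enc \<in> {A. signed_set n A} \<rightarrow> {1..n} \<rightarrow>\<^sub>E {0, 1, 2}"
      by (auto simp: enc_def block_def)
    have "signed_set n (dec f)" for f
      unfolding signed_set_def
    proof (intro conjI ballI)
      show "dec f \<subseteq> {1..2 * n}" by (auto simp: dec_def)
      fix a assume "a \<in> dec f"
      then consider "a \<in> {1..n}" "f a = 0" | "a \<in> {n + 1..2 * n}" "f (bar n a) = 2"
        unfolding dec_def Un_iff mem_Collect_eq by argo
      then show "bar n a \<notin> dec f"
      proof cases
        case 1
        then have "bar n a \<notin> {1..n}" "bar n (bar n a) = a" by auto
        then show ?thesis using 1 unfolding dec_def by auto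
      next
        case 2
        then have "bar n a \<notin> {n + 1..2 * n}" by auto
        then show ?thesis using 2 unfolding dec_def by auto
      qed
    qed
    then show "dec \<in> ({1..n} \<rightarrow>\<^sub>E {0, 1, 2}) \<rightarrow> {A. signed_set n A}"
      by blast
    show "dec (enc A) = A" if "A \<in> {A. signed_set n A}" for A
    proof (rule Set.set_eqI)
      fix v
      have sub: "A \<subseteq> {1..2 * n}" and bar_A: "\<And>a. a \<in> A \<Longrightarrow> bar n a \<notin> A"
        using that by (auto simp: signed_set_def)
      consider "v \<in> {1..n}" | "v \<in> {n + 1..2 * n}" | "v \<notin> {1..2 * n}" by fastforce
      then show "v \<in> dec (enc A) \<longleftrightarrow> v \<in> A"
      proof cases
        case 1
        then show ?thesis by (auto simp: dec_def enc_def block_def)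
      next
        case 2
        then have "bar n v \<in> {1..n}" "bar n (bar n v) = v" "v \<notin> {1..n}" by auto
        then show ?thesis using 2 bar_A[of v] unfolding dec_def enc_def block_def by auto
      next
        case 3
        then show ?thesis using sub by (auto simp: dec_def)
      qed
    qed
    show "enc (dec f) = f" if f: "f \<in> {1..n} \<rightarrow>\<^sub>E {0, 1, 2}" for f
    proof (rule ext)
      fix i
      show "enc (dec f) i = f i"
      proof (cases "i \<in> {1..n}")
        case True
        then have "f i = 0 \<or> f i = 1 \<or> f i = 2"
          using PiE_mem[OF f True] by simp
        moreover have "bar n i \<in> {n + 1..2 * n}" "bar n i \<notin> {1..n}"
          "i \<notin> {n + 1..2 * n}" "bar n (bar n i) = i"
          using True by auto
        ultimately show ?thesis using True unfolding enc_def block_def dec_def by auto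
      next
        case False
        then show ?thesis by (simp only: enc_def restrict_def if_False PiE_arb[OF f False])
      qed
    qed
  qed
  then have "card {A. signed_set n A} = card ({1..n} \<rightarrow>\<^sub>E {0, 1, 2::nat})"
    by (rule bij_betw_same_card)
  then show ?thesis by (simp add: card_PiE numeral_3_eq_3)
qed

lemma card_good_signed_sets:
  assumes n: "n \<ge> 1"
  shows "card {A. signed_set n A \<and> A \<noteq> {} \<and> A \<noteq> {1..card A} \<and> A \<noteq> {2 * n + 1 - card A..2 * n}}
    + (2 * n + 1) = 3 ^ n"
proof -
  let ?all = "{A. signed_set n A}"
  \<comment> \<open>Starting at 0 puts the empty set into \<open>lo\<close>; starting
    \<open>hi\<close> at 1 avoids counting it twice.\<close>
  define lo where "lo = (\<lambda>d. {1..d::nat}) ` {0..n}"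
  define hi where "hi = (\<lambda>d. {2 * n + 1 - d..2 * n}) ` {1..n}"
  have fin: "finite ?all"
    by (rule finite_subset[of _ "Pow {1..2 * n}"]) (auto simp: signed_set_def)
  have sub: "lo \<union> hi \<subseteq> ?all"
    unfolding lo_def hi_def by (auto simp: signed_set_def)
  have "{A. signed_set n A \<and> A \<noteq> {} \<and> A \<noteq> {1..card A} \<and> A \<noteq> {2 * n + 1 - card A..2 * n}}
      = ?all - (lo \<union> hi)"
  proof (intro equalityI subsetI)
    fix A assume A: "A \<in> {A. signed_set n A \<and> A \<noteq> {} \<and> A \<noteq> {1..card A} \<and> A \<noteq> {2 * n + 1 - card A..2 * n}}"
    have "A \<notin> lo" using A by (auto simp: lo_def)
    moreover have "A \<notin> hi" using A by (auto simp: hi_def)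
    ultimately show "A \<in> ?all - (lo \<union> hi)" using A by blast
  next
    fix A assume A: "A \<in> ?all - (lo \<union> hi)"
    then have le: "card A \<le> n" using card_signed_set_le by blast
    have 1: "A \<noteq> {1..card A}"
    proof
      assume "A = {1..card A}"
      then have "A \<in> lo" using le unfolding lo_def by (intro image_eqI[where x = "card A"]) auto
      then show False using A by blast
    qed
    then have 2: "A \<noteq> {}" by auto
    moreover have "A \<noteq> {2 * n + 1 - card A..2 * n}"
    proof
      assume eq: "A = {2 * n + 1 - card A..2 * n}"
      have "finite A" using A finite_subset[of A "{1..2 * n}"] by (auto simp: signed_set_def)
      then have "card A \<ge> 1" using 2 by (simp add: Suc_leI card_gt_0_iff)
      then have "A \<in> hi" using eq le unfolding hi_def by (intro image_eqI[where x = "card A"]) auto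
      then show False using A by blast
    qed
    ultimately show "A \<in> {A. signed_set n A \<and> A \<noteq> {} \<and> A \<noteq> {1..card A} \<and> A \<noteq> {2 * n + 1 - card A..2 * n}}"
      using A 1 by blast
  qed
  moreover have "card (lo \<union> hi) = 2 * n + 1"
  proof -
    have "inj_on (\<lambda>d. {1..d::nat}) {0..n}"
      by (rule inj_onI) (metis card_atLeastAtMost diff_Suc_1)
    then have "card lo = n + 1" unfolding lo_def by (simp add: card_image)
    moreover have "inj_on (\<lambda>d. {2 * n + 1 - d..2 * n}) {1..n}"
    proof (rule inj_onI)
      fix d e assume "d \<in> {1..n}" "e \<in> {1..n}" "{2 * n + 1 - d..2 * n} = {2 * n + 1 - e..2 * n}"
      then show "d = e" by (auto simp: Icc_eq_Icc)
    qed
    then have "card hi = n" unfolding hi_def by (simp add: card_image)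
    \<comment> \<open>The value \<open>2 * n\<close> lies in every member of \<open>hi\<close>,
      while members of \<open>lo\<close> stop at n, which is smaller because
      \<open>n \<ge> 1\<close>.\<close>
    moreover have "lo \<inter> hi = {}"
    proof -
      have "2 * n \<in> A" if "A \<in> hi" for A using that by (auto simp: hi_def)
      moreover have "2 * n \<notin> A" if "A \<in> lo" for A using that n by (auto simp: lo_def)
      ultimately show ?thesis by blast
    qed
    moreover have "finite lo" "finite hi" by (simp_all add: lo_def hi_def)
    ultimately show ?thesis by (simp add: card_Un_disjoint)
  qed
  moreover have "card (lo \<union> hi) \<le> card ?all" using fin sub by (rule card_mono)
  moreover have "card (?all - (lo \<union> hi)) = card ?all - card (lo \<union> hi)"
    by (rule card_Diff_subset[OF finite_subset[OF sub fin] sub])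
  ultimately show ?thesis using card_signed_sets[of n] by (simp only: le_add_diff_inverse2)
qed

text \<open>Sending a word to its values before the descent is a bijection onto the admissible
  signed sets. The additive form avoids truncated subtraction on naturals.\<close>

lemma card_Pop_image_single_descent:
  assumes n: "n \<ge> 1"
  shows "card {w \<in> Pop (Weak_B n) ` B n. \<exists>d. single_descent n w d} + (2 * n + 1) = 3 ^ n"
proof -
  let ?W = "{w \<in> Pop (Weak_B n) ` B n. \<exists>d. single_descent n w d}"
  let ?S = "{A. signed_set n A \<and> A \<noteq> {} \<and> A \<noteq> {1..card A} \<and> A \<noteq> {2 * n + 1 - card A..2 * n}}"
  \<comment> \<open>A single descent has a unique position, so the description is well defined on
    the words considered.\<close>
  define pre where "pre w = w ` {1..THE d. single_descent n w d}" for w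
  have pre_eq: "pre w = w ` {1..d}" if "single_descent n w d" for w d
  proof -
    have "(THE d. single_descent n w d) = d"
      using that by (intro the_equality) (auto simp: single_descent_def)
    then show ?thesis by (simp add: pre_def)
  qed
  have mem: "w \<in> B n" if "w \<in> Pop (Weak_B n) ` B n" for w
    using that flip_mem mirror_symmetric_descents Pop_Weak_B by auto
  have "bij_betw pre ?W ?S"
    unfolding bij_betw_def
  proof (intro conjI equalityI subsetI)
    show "inj_on pre ?W"
    proof (rule inj_onI)
      fix v w assume "v \<in> ?W" "w \<in> ?W" and eq: "pre v = pre w"
      then obtain d e where v: "v \<in> B n" "single_descent n v d" and w: "w \<in> B n" "single_descent n w e"
        using mem by blast
      have "v ` {1..d} = w ` {1..e}" using eq pre_eq v(2) w(2) by simp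
      then have "inversions n v = inversions n w"
        by (simp only: inversions_single_descent[OF v] inversions_single_descent[OF w])
      then show "v = w" by (rule inversions_inject[OF v(1) w(1)])
    qed
  next
    fix A assume "A \<in> pre ` ?W"
    then obtain w d x where sd: "single_descent n w d" and A: "A = w ` {1..d}"
      and x: "x \<in> B n" "w = Pop (Weak_B n) x"
      using pre_eq by auto
    have w: "w \<in> B n" using x mem by blast
    have d: "d \<in> {1..n}" "w (d + 1) < w d" using sd by (auto simp: single_descent_def)
    have card: "card A = d" unfolding A using B_eq_iff[OF w] by (simp add: card_image inj_on_def)
    have signed: "signed_set n A" unfolding A using d by (intro signed_set_prefix[OF w]) auto
    have "A \<noteq> {1..d}"
    proof
      assume eq: "A = {1..d}"
      have "w d \<in> A" using d unfolding A by auto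
      moreover have "w (d + 1) \<notin> A" unfolding A using mem_prefix_iff[OF w, of "d + 1" d] by simp
      moreover have "w (d + 1) \<in> {1..2 * n}" using d by (intro B_mem[OF w]) auto
      ultimately show False using d(2) unfolding eq by auto
    qed
    moreover have "A \<noteq> {2 * n + 1 - d..2 * n}"
    proof
      assume "A = {2 * n + 1 - d..2 * n}"
      then show False using Pop_image_overlap[OF x d(1)] unfolding A[symmetric] by auto
    qed
    moreover have "A \<noteq> {}" using card d by auto
    ultimately show "A \<in> ?S" using card signed by simp
  next
    fix A assume "A \<in> ?S"
    then obtain w where "w \<in> Pop (Weak_B n) ` B n" "single_descent n w (card A)" "w ` {1..card A} = A"
      using Pop_image_of_signed_set[of n A] by blast
    then show "A \<in> pre ` ?W" using pre_eq by (intro image_eqI[where x = w]) auto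
  qed
  then have "card ?W = card ?S" by (rule bij_betw_same_card)
  then show ?thesis using card_good_signed_sets[OF n] by simp
qed

lemma coeff_sum_monom:
  assumes "finite S"
  shows "coeff (\<Sum>b\<in>S. monom 1 (f b)) m = int (card {b \<in> S. f b = m})"
  using assms by (simp add: coeff_sum sum.If_cases Int_def)

theorem mainTheorem1:
  fixes n :: nat
  assumes "n \<ge> 1"
  shows "coeff (Pop_poly (Weak_B n)) (n - 1) = 3 ^ n - 2 * int n - 1 \<and>
         int (card {x \<in> Pop (Weak_B n) ` carrier (Weak_B n).
                      card (upper_covers (Weak_B n) x) = n - 1}) = 3 ^ n - 2 * int n - 1"
proof -
  let ?P = "Pop (Weak_B n) ` B n"
  have "finite (B n)"
    by (rule finite_subset[OF _ finite_permutations[of "{1..2 * n}"]]) (auto simp: B_def)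
  moreover have "?P \<subseteq> B n"
    using flip_mem mirror_symmetric_descents Pop_Weak_B by auto
  then have "card (upper_covers (Weak_B n) x) = n - 1 \<longleftrightarrow> (\<exists>d. single_descent n x d)"
    if "x \<in> ?P" for x
    using card_upper_covers_Weak_B[OF _ assms] card_ascents_eq_iff[OF _ assms] that
    by (simp only: subset_iff)
  then have "{x \<in> ?P. card (upper_covers (Weak_B n) x) = n - 1} = {w \<in> ?P. \<exists>d. single_descent n w d}"
    by (rule Collect_cong[OF conj_cong[OF refl]])
  moreover have "int (card {w \<in> ?P. \<exists>d. single_descent n w d}) = 3 ^ n - 2 * int n - 1"
  proof -
    have "int (card {w \<in> ?P. \<exists>d. single_descent n w d} + (2 * n + 1)) = int (3 ^ n)"
      using card_Pop_image_single_descent[OF assms] by (simp only:)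
    then show ?thesis by simp
  qed
  ultimately show ?thesis
    unfolding Pop_poly_def carrier_Weak_B by (simp add: coeff_sum_monom)
qed

end
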